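(* Let $b$ be a prime, $m\in\mathbb{N}$, $N=b^m$, $s\in\mathbb{N}$, $\alpha>1$, let $(\gamma_{\mathfrak{u}})_{\mathfrak{u}\subseteq[s]}$ be positive weights with $\gamma_\emptyset=1$, let $0\le w_1\le w_2\le\cdots\le w_s$ be integers, and put $Y_j=b^{w_j}$ for $j\in[s]$. Let $\boldsymbol{z}^0\in\{0,1,\ldots,N-1\}^s$ be an arbitrary initial vector and let $\boldsymbol{z}=(Y_1z_1,\ldots,Y_sz_s)$ be constructed by the reduced successive coordinate search (SCS) algorithm (defined in the context) with initial vector $\boldsymbol{z}^0$. Then, for every $\lambda\in(\frac1\alpha,1]$, the squared worst-case error in the weighted Korobov space $\mathcal{H}(K_{s,\alpha,\boldsymbol{\gamma}})$ satisfies $$e_{N,s}^2\big((Y_1z_1,\ldots,Y_sz_s)\big)\le\left(\sum_{d=1}^s\ \sum_{d\in\mathfrak{u}\subseteq[s]}\gamma_{\mathfrak{u}}^{\lambda}\,\frac{2\,(2\zeta(\alpha\lambda))^{|\mathfrak{u}|}}{b^{\max(0,m-w_d)}}\right)^{1/\lambda},$$ where $\zeta$ is the Riemann zeta function and the inner sum is over all $\mathfrak{u}\subseteq[s]$ containing $d$.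
   Context: Notation: $[s]=\{1,\ldots,s\}$, $\mathbb{Z}_*=\mathbb{Z}\setminus\{0\}$; for a vector $\boldsymbol{x}$ and $\mathfrak{u}\subseteq[s]$, $\boldsymbol{x}_{\mathfrak{u}}=(x_j)_{j\in\mathfrak{u}}$; $\{\cdot\}$ is the fractional part, applied componentwise. Weighted Korobov space: $\mathcal{H}(K_{s,\alpha,\boldsymbol{\gamma}})$ is the reproducing kernel Hilbert space of functions on $[0,1]^s$ with kernel $$K_{s,\alpha,\boldsymbol{\gamma}}(\boldsymbol{x},\boldsymbol{y})=1+\sum_{\emptyset\ne\mathfrak{u}\subseteq[s]}\gamma_{\mathfrak{u}}\sum_{\boldsymbol{h}_{\mathfrak{u}}\in\mathbb{Z}_*^{|\mathfrak{u}|}}\frac{\exp(2\pi \mathrm{i}\,\boldsymbol{h}_{\mathfrak{u}}\cdot(\boldsymbol{x}_{\mathfrak{u}}-\boldsymbol{y}_{\mathfrak{u}}))}{\prod_{j\in\mathfrak{u}}|h_j|^\alpha}.$$ Worst-case error: for $\boldsymbol{\xi}\in\mathbb{Z}^s$, $e_{N,s}(\boldsymbol{\xi})$ is the supremum of $\left|\int_{[0,1]^s}f(\boldsymbol{x})\,\mathrm{d}\boldsymbol{x}-\frac1N\sum_{n=0}^{N-1}f(\{n\boldsymbol{\xi}/N\})\right|$ over all $f$ in the unit ball of $\mathcal{H}(K_{s,\alpha,\boldsymbol{\gamma}})$. It is known that $$e_{N,s}^2(\boldsymbol{\xi})=\sum_{\emptyset\ne\mathfrak{u}\subseteq[s]}\gamma_{\mathfrak{u}}\sum_{\boldsymbol{h}_{\mathfrak{u}}\in\mathcal{D}_{\mathfrak{u}}(\boldsymbol{\xi}_{\mathfrak{u}})}\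 \prod_{j\in\mathfrak{u}}|h_j|^{-\alpha},\qquad \mathcal{D}_{\mathfrak{u}}(\boldsymbol{\xi}_{\mathfrak{u}})=\{\boldsymbol{h}_{\mathfrak{u}}\in\mathbb{Z}_*^{|\mathfrak{u}|}:\boldsymbol{h}_{\mathfrak{u}}\cdot\boldsymbol{\xi}_{\mathfrak{u}}\equiv0\ (\mathrm{mod}\ N)\}.$$ Search spaces: $\mathcal{Z}_{N,w_j}=\{z\in\{1,2,\ldots,b^{m-w_j}-1\}:\gcd(z,N)=1\}$ if $w_j<m$, and $\mathcal{Z}_{N,w_j}=\{1\}$ if $w_j\ge m$. Reduced SCS algorithm: given $\boldsymbol{z}^0=(z_1^0,\ldots,z_s^0)$, for $d=1,2,\ldots,s$ successively, with $z_1,\ldots,z_{d-1}$ already selected, choose $z_d\in\mathcal{Z}_{N,w_d}$ such that $e_{N,s}^2((Y_1z_1,\ldots,Y_{d-1}z_{d-1},Y_dz_d,z_{d+1}^0,\ldots,z_s^0))$ is minimized as a function of $z_d$ over $\mathcal{Z}_{N,w_d}$. The output is $\boldsymbol{z}=(Y_1z_1,\ldots,Y_sz_s)$. *)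

theory Defs
  imports "HOL-Analysis.Analysis" "HOL-Computational_Algebra.Primes"
begin

section \<open>Reproducing kernel Hilbert spaces\<close>

definition ip_norm :: "(('a \<Rightarrow> complex) \<Rightarrow> ('a \<Rightarrow> complex) \<Rightarrow> complex) \<Rightarrow> ('a \<Rightarrow> complex) \<Rightarrow> real"
  where "ip_norm ip f = sqrt (Re (ip f f))"

text \<open>
  A Hilbert space of complex-valued functions on a set \<open>X\<close> is a set \<open>H\<close> of functions with an
  inner product \<open>ip\<close>, linear in its first argument. A function on \<open>X\<close> is represented by its
  extension by zero to the whole type, so that equality of functions is equality on \<open>X\<close> and the
  vector space operations are the pointwise ones.
\<close>

locale function_hilbert_space =
  fixes X :: "'a set"
    and H :: "('a \<Rightarrow> complex) set"
    and ip :: "('a \<Rightarrow> complex) \<Rightarrow> ('a \<Rightarrow> complex) \<Rightarrow> complex"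
  assumes zero_outside: "f \<in> H \<Longrightarrow> x \<notin> X \<Longrightarrow> f x = 0"
    and zero_closed: "(\<lambda>x. 0) \<in> H"
    and add_closed: "f \<in> H \<Longrightarrow> g \<in> H \<Longrightarrow> (\<lambda>x. f x + g x) \<in> H"
    and scale_closed: "f \<in> H \<Longrightarrow> (\<lambda>x. c * f x) \<in> H"
    and ip_add: "f \<in> H \<Longrightarrow> g \<in> H \<Longrightarrow> h \<in> H \<Longrightarrow> ip (\<lambda>x. f x + g x) h = ip f h + ip g h"
    and ip_scale: "f \<in> H \<Longrightarrow> h \<in> H \<Longrightarrow> ip (\<lambda>x. c * f x) h = c * ip f h"
    and ip_commute: "f \<in> H \<Longrightarrow> g \<in> H \<Longrightarrow> ip g f = cnj (ip f g)"
    and ip_nonneg: "f \<in> H \<Longrightarrow> 0 \<le> Re (ip f f)"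
    and ip_definite: "f \<in> H \<Longrightarrow> ip f f = 0 \<Longrightarrow> f = (\<lambda>x. 0)"
    and complete:
      "(\<And>n::nat. F n \<in> H) \<Longrightarrow>
       (\<And>e. e > 0 \<Longrightarrow> \<exists>M. \<forall>k\<ge>M. \<forall>n\<ge>M. ip_norm ip (\<lambda>x. F k x - F n x) < e) \<Longrightarrow>
       \<exists>f\<in>H. (\<lambda>n. ip_norm ip (\<lambda>x. F n x - f x)) \<longlonglongrightarrow> 0"

text \<open>
  By the Moore-Aronszajn theorem every positive definite kernel \<open>K\<close> has exactly one such space
  (\<open>ip\<close> being determined on \<open>H\<close> only).
\<close>

locale rkhs = function_hilbert_space X H ip
  for X :: "'a set"
    and K :: "'a \<Rightarrow> 'a \<Rightarrow> complex"
    and H :: "('a \<Rightarrow> complex) set"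
    and ip :: "('a \<Rightarrow> complex) \<Rightarrow> ('a \<Rightarrow> complex) \<Rightarrow> complex" +
  assumes kernel_in: "y \<in> X \<Longrightarrow> (\<lambda>x. if x \<in> X then K x y else 0) \<in> H"
    and reproducing: "f \<in> H \<Longrightarrow> y \<in> X \<Longrightarrow> ip f (\<lambda>x. if x \<in> X then K x y else 0) = f y"


section \<open>The weighted Korobov space and the worst-case error\<close>

text \<open>
  Vectors indexed by a finite set \<open>u\<close> of positive integers are functions on \<open>nat\<close>. In \<open>unit_cube\<close>
  and in the kernel they are extensional, i.e. \<open>undefined\<close> outside the index set.
\<close>

definition unit_cube :: "nat \<Rightarrow> (nat \<Rightarrow> real) set"
  where "unit_cube s = {1..s} \<rightarrow>\<^sub>E {0..1}"

definition korobov_kernel ::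
    "nat \<Rightarrow> real \<Rightarrow> (nat set \<Rightarrow> real) \<Rightarrow> (nat \<Rightarrow> real) \<Rightarrow> (nat \<Rightarrow> real) \<Rightarrow> complex"
  where "korobov_kernel s \<alpha> \<gamma> x y =
    1 + (\<Sum>u \<in> Pow {1..s} - {{}}. complex_of_real (\<gamma> u) *
          (\<Sum>\<^sub>\<infinity>h \<in> u \<rightarrow>\<^sub>E (UNIV - {0::int}).
             exp (2 * complex_of_real pi * \<i> *
                  complex_of_real (\<Sum>j\<in>u. real_of_int (h j) * (x j - y j))) /
             complex_of_real (\<Prod>j\<in>u. real_of_int \<bar>h j\<bar> powr \<alpha>)))"

definition lattice_point :: "nat \<Rightarrow> nat \<Rightarrow> (nat \<Rightarrow> int) \<Rightarrow> nat \<Rightarrow> (nat \<Rightarrow> real)"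
  where "lattice_point N s \<xi> n = (\<lambda>j\<in>{1..s}. frac (real n * real_of_int (\<xi> j) / real N))"

definition worst_case_error ::
    "((nat \<Rightarrow> real) \<Rightarrow> complex) set \<Rightarrow>
     (((nat \<Rightarrow> real) \<Rightarrow> complex) \<Rightarrow> ((nat \<Rightarrow> real) \<Rightarrow> complex) \<Rightarrow> complex) \<Rightarrow>
     nat \<Rightarrow> nat \<Rightarrow> (nat \<Rightarrow> int) \<Rightarrow> real"
  where "worst_case_error H ip N s \<xi> =
    (SUP f \<in> {f \<in> H. ip_norm ip f \<le> 1}.
       cmod ((LINT x:unit_cube s|PiM {1..s} (\<lambda>_. lborel). f x)
             - (\<Sum>n<N. f (lattice_point N s \<xi> n)) / of_nat N))"


section \<open>The reduced successive coordinate search algorithm\<close>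

definition search_space :: "nat \<Rightarrow> nat \<Rightarrow> nat \<Rightarrow> int set"
  where "search_space b m w =
    (if w < m then {z \<in> {1..int b ^ (m - w) - 1}. gcd z (int (b ^ m)) = 1} else {1})"

text \<open>
  The minimizer in step \<open>d\<close> need not be unique, so the algorithm is described by the relation
  between the initial vector \<open>z0\<close> and its possible outcomes. The argument \<open>e\<close> is the error as a
  function of the generating vector; the components \<open>z d\<close> are the selected ones, before
  multiplication by \<open>b ^ w d\<close>.
\<close>

definition reduced_scs ::
    "((nat \<Rightarrow> int) \<Rightarrow> real) \<Rightarrow> nat \<Rightarrow> nat \<Rightarrow> nat \<Rightarrow> (nat \<Rightarrow> nat) \<Rightarrow> (nat \<Rightarrow> int) \<Rightarrow> (nat \<Rightarrow> int) \<Rightarrow> bool"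
  where "reduced_scs e b m s w z0 z \<longleftrightarrow>
    (\<forall>d\<in>{1..s}.
       is_arg_min
         (\<lambda>zd. (e (\<lambda>j. if j < d then int b ^ w j * z j
                       else if j = d then int b ^ w d * zd
                       else z0 j))\<^sup>2)
         (\<lambda>zd. zd \<in> search_space b m (w d))
         (z d))"


section \<open>The Riemann zeta function on the half-line \<open>x > 1\<close>\<close>

definition zeta :: "real \<Rightarrow> real"
  where "zeta x = (\<Sum>n. 1 / real (Suc n) powr x)"

end

theory Submission
  imports Defs "HOL-Number_Theory.Totient"
begin

text \<open>
  By Riesz representation, integration over the cube is represented by the constant function 1,
  so the squared worst-case error is the squared norm of 1 minus the mean of the kernel functions
  at the lattice points, and orthogonality of characters turns this into a weighted sum of sums
  \<open>T u\<close> over dual lattices.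

  A set \<open>u\<close> with largest element \<open>d\<close> only sees the components chosen up to step \<open>d\<close>. So the sum of
  the \<open>T u\<close> over these sets is at most the sum over all \<open>u\<close> containing \<open>d\<close>, evaluated right after
  step \<open>d\<close>, where it is minimal in \<open>z d\<close>. By the subadditivity of \<open>x \<mapsto> x powr lam\<close> the minimum
  can be replaced by a mean over the search space. In that mean all other components are arbitrary:
  the congruence \<open>h * z + c \<equiv> 0\<close> modulo \<open>M\<close> has at most \<open>gcd h M\<close> solutions \<open>z\<close>, and it is solvable by
  a unit \<open>z\<close> only if \<open>gcd h M = gcd c M\<close>.
\<close>

section \<open>Congruences averaged over the search space\<close>

lemma zeta_summable:
  assumes "a > 1"
  shows "summable (\<lambda>n. 1 / real (Suc n) powr a)"
proof -
  have "summable (\<lambda>n. real n powr (-a))"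
    using assms by (simp add: summable_real_powr_iff)
  then have "summable (\<lambda>n. real (Suc n) powr (-a))"
    by (subst summable_Suc_iff)
  then show ?thesis
    by (simp add: powr_minus_divide)
qed

lemma zeta_nonneg: "a > 1 \<Longrightarrow> zeta a \<ge> 0"
  unfolding zeta_def by (intro suminf_nonneg zeta_summable) auto

lemma sum_powr_le_zeta_pos:
  fixes A :: "int set"
  assumes "a > 1" "finite A" "\<And>h. h \<in> A \<Longrightarrow> h > 0"
  shows "(\<Sum>h\<in>A. real_of_int \<bar>h\<bar> powr (-a)) \<le> zeta a"
proof -
  have "(\<Sum>h\<in>A. real_of_int \<bar>h\<bar> powr (-a))
      = (\<Sum>n\<in>(\<lambda>h. nat (h - 1)) ` A. 1 / real (Suc n) powr a)"
  proof (subst sum.reindex)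
    show "inj_on (\<lambda>h. nat (h - 1)) A"
    proof (rule inj_onI)
      fix x y assume "x \<in> A" "y \<in> A" "nat (x - 1) = nat (y - 1)"
      with assms(3) [of x] assms(3) [of y] show "x = y" by linarith
    qed
    show "(\<Sum>h\<in>A. real_of_int \<bar>h\<bar> powr (-a))
        = sum ((\<lambda>n. 1 / real (Suc n) powr a) \<circ> (\<lambda>h. nat (h - 1))) A"
      by (intro sum.cong refl) (use assms(3) in \<open>force simp: powr_minus_divide\<close>)
  qed
  also have "\<dots> \<le> zeta a"
    unfolding zeta_def using assms by (intro sum_le_suminf zeta_summable) auto
  finally show ?thesis .
qed

text \<open>Each sign contributes at most one zeta value. Finite index sets make the averaging over
  the search space a matter of finite sums; infinite sums are bounded afterwards through their
  finite partial sums.\<close>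

lemma sum_powr_le_zeta:
  fixes A :: "int set"
  assumes "a > 1" "finite A" "0 \<notin> A"
  shows "(\<Sum>h\<in>A. real_of_int \<bar>h\<bar> powr (-a)) \<le> 2 * zeta a"
proof -
  let ?f = "\<lambda>h::int. real_of_int \<bar>h\<bar> powr (-a)"
  have "sum ?f A = sum ?f {h\<in>A. h > 0} + sum ?f {h\<in>A. h < 0}"
    using assms by (subst sum.union_disjoint [symmetric]) (auto intro!: sum.cong, metis linorder_neqE)
  also have "sum ?f {h\<in>A. h < 0} = sum ?f (uminus ` {h\<in>A. h < 0})"
    by (subst sum.reindex) auto
  also have "sum ?f {h\<in>A. h > 0} + \<dots> \<le> zeta a + zeta a"
    using assms by (intro add_mono sum_powr_le_zeta_pos) auto
  finally show ?thesis by simp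
qed

text \<open>Division by \<open>g\<close> maps \<open>A\<close> injectively to nonzero integers, and
  each term releases a factor \<open>g powr (-a)\<close>.\<close>

lemma sum_powr_multiples_le_zeta:
  fixes A :: "int set"
  assumes "a > 1" "finite A" "0 \<notin> A" "g > 0" "\<And>h. h \<in> A \<Longrightarrow> g dvd h"
  shows "(\<Sum>h\<in>A. real_of_int \<bar>h\<bar> powr (-a)) \<le> 2 * zeta a * real_of_int g powr (-a)"
proof -
  let ?f = "\<lambda>h::int. real_of_int \<bar>h\<bar> powr (-a)"
  have "sum ?f A = (\<Sum>h\<in>A. ?f (h div g) * real_of_int g powr (-a))"
  proof (intro sum.cong refl)
    fix h assume "h \<in> A"
    then obtain k where "h = g * k" using assms(5) by blast
    then show "?f h = ?f (h div g) * real_of_int g powr (-a)"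
      using assms(4) by (simp add: abs_mult powr_mult)
  qed
  also have "\<dots> = sum ?f ((\<lambda>h. h div g) ` A) * real_of_int g powr (-a)"
    by (subst sum.reindex) 
      (use assms(5) in \<open>auto simp: inj_on_def sum_distrib_right dvd_div_eq_iff\<close>)
  also have "\<dots> \<le> 2 * zeta a * real_of_int g powr (-a)"
  proof (intro mult_right_mono sum_powr_le_zeta)
    show "0 \<notin> (\<lambda>h. h div g) ` A"
      using assms(3,5) by (auto simp: dvd_div_eq_0_iff)
  qed (use assms in auto)
  finally show ?thesis .
qed

section \<open>Linear congruences and their unit solutions\<close>

text \<open>Two solutions agree modulo \<open>q = M div g\<close>, where \<open>g = gcd h M\<close>.
  So a solution is determined by \<open>z div q\<close>, which takes only \<open>g\<close> values on
  \<open>{0..<M}\<close>.\<close>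

lemma card_linear_congruence_le:
  fixes M h c :: int
  assumes "M > 0"
  shows "card {z\<in>{0..<M}. M dvd h * z + c} \<le> nat (gcd h M)"
proof -
  define g where "g = gcd h M"
  define q where "q = M div g"
  have g: "g > 0" "g dvd h" "g dvd M" using assms by (auto simp: g_def)
  have M: "M = g * q" using g by (simp add: q_def)
  have q: "q > 0" using M g assms by (simp add: zero_less_mult_iff)
  have cop: "coprime (h div g) q"
    unfolding q_def g_def using assms by (intro div_gcd_coprime) auto
  let ?S = "{z\<in>{0..<M}. M dvd h * z + c}"
  have "inj_on (\<lambda>z. z div q) ?S"
  proof (rule inj_onI)
    fix x y assume xy: "x \<in> ?S" "y \<in> ?S" "x div q = y div q"
    then have "M dvd (h * x + c) - (h * y + c)" by (intro dvd_diff) auto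
    also have "(h * x + c) - (h * y + c) = g * (h div g * (x - y))"
    proof -
      have "h = g * (h div g)" using g by simp
      then show ?thesis by (metis (no_types, opaque_lifting) add_diff_cancel_right mult.assoc right_diff_distrib)
    qed
    finally have "q dvd h div g * (x - y)"
      using M g by simp
    then have "q dvd x - y"
      using cop by (simp add: coprime_commute coprime_dvd_mult_right_iff)
    then have "x mod q = y mod q" by (simp add: mod_eq_dvd_iff)
    with xy(3) show "x = y" by (metis div_mult_mod_eq)
  qed
  moreover have "(\<lambda>z. z div q) ` ?S \<subseteq> {0..<g}"
  proof (rule image_subsetI)
    fix z assume "z \<in> ?S"
    then have "0 \<le> z" "z < g * q" by (auto simp: M)
    moreover have "z div q * q \<le> z" using q by (metis div_mult_mod_eq le_add_same_cancel1 pos_mod_sign)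
    ultimately have "z div q < g" using q by (meson le_less_trans mult_less_cancel_right_pos)
    with \<open>0 \<le> z\<close> q show "z div q \<in> {0..<g}" by (simp add: pos_imp_zdiv_nonneg_iff)
  qed
  ultimately have "card ?S \<le> card {0..<g}"
    by (intro card_inj_on_le) auto
  then show ?thesis by (simp add: g_def)
qed

lemma sum_units_congruence_le:
  fixes M c :: int and A Z :: "int set"
  assumes "a > 1" "finite A" "0 \<notin> A" "M > 0"
    and Z: "Z \<subseteq> {0..<M}" "\<And>z. z \<in> Z \<Longrightarrow> coprime z M"
  shows "(\<Sum>z\<in>Z. \<Sum>h\<in>A. if M dvd h * z + c then real_of_int \<bar>h\<bar> powr (-a) else 0) \<le> 2 * zeta a"
proof -
  define g where "g = gcd c M"
  have g: "g \<ge> 1" using assms by (simp add: g_def int_one_le_iff_zero_less)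
  have finZ: "finite Z" using Z finite_subset by blast
  let ?f = "\<lambda>h::int. real_of_int \<bar>h\<bar> powr (-a)"
  have "(\<Sum>z\<in>Z. \<Sum>h\<in>A. if M dvd h * z + c then ?f h else 0)
      = (\<Sum>h\<in>A. \<Sum>z\<in>Z. if M dvd h * z + c then ?f h else 0)"
    by (rule sum.swap)
  also have "\<dots> = (\<Sum>h\<in>A. ?f h * real (card {z\<in>Z. M dvd h * z + c}))"
    using finZ by (simp add: sum.If_cases Int_def mult.commute)
  also have "\<dots> \<le> (\<Sum>h\<in>A. if gcd h M = g then ?f h * g else 0)"
  proof (intro sum_mono)
    fix h assume "h \<in> A"
    show "?f h * real (card {z\<in>Z. M dvd h * z + c}) \<le> (if gcd h M = g then ?f h * g else 0)"
    proof (cases "gcd h M = g")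
      case True
      have "card {z\<in>Z. M dvd h * z + c} \<le> card {z\<in>{0..<M}. M dvd h * z + c}"
        using Z by (intro card_mono finite_subset [of "{z\<in>{0..<M}. M dvd h * z + c}" "{0..<M}"]) auto
      also have "\<dots> \<le> nat g"
        using card_linear_congruence_le [OF assms(4), of h c] True by simp
      finally show ?thesis using True g by (auto intro!: mult_left_mono)
    next
      case False
      \<comment> \<open>A solution \<open>z\<close> would make \<open>c\<close> congruent to
        \<open>- (h * z)\<close> modulo \<open>M\<close>, and the unit \<open>z\<close> drops out of
        the gcd, forcing \<open>gcd c M = gcd h M\<close>.\<close>
      have "{z\<in>Z. M dvd h * z + c} = {}"
      proof (rule ccontr)
        assume "{z\<in>Z. M dvd h * z + c} \<noteq> {}"
        then obtain z where z: "z \<in> Z" "M dvd h * z + c" by blast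
        then have "[c = - (h * z)] (mod M)"
          by (simp add: cong_iff_dvd_diff add.commute)
        then have "gcd c M = gcd (h * z) M"
          using cong_gcd_eq by fastforce
        also have "\<dots> = gcd h M"
          using Z(2) [OF z(1)] by (simp add: gcd_mult_right_right_cancel gcd_mult_left_right_cancel coprime_commute)
        finally show False using False g_def by simp
      qed
      then have "card {z\<in>Z. M dvd h * z + c} = 0" by (simp only: card.empty)
      then show ?thesis using False by simp
    qed
  qed
  also have "\<dots> = g * (\<Sum>h | h \<in> A \<and> gcd h M = g. ?f h)"
    using assms(2) by (simp add: sum.If_cases Int_def sum_distrib_left mult.commute)
  also have "\<dots> \<le> g * (2 * zeta a * real_of_int g powr (-a))"
    using g assms by (intro mult_left_mono sum_powr_multiples_le_zeta) auto
  also have "\<dots> = 2 * zeta a * real_of_int g powr (1 - a)"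
    using g by (simp add: powr_diff powr_minus_divide)
  also have "\<dots> \<le> 2 * zeta a * 1"
    using g assms zeta_nonneg [of a] powr_mono [of "1 - a" 0 "real_of_int g"]
    by (intro mult_left_mono) auto
  finally show ?thesis by simp
qed

section \<open>Weighted sums over boxes and their means over the search space\<close>

lemma sum_PiE_insert:
  fixes F :: "('i \<Rightarrow> 'a) \<Rightarrow> 'b::comm_monoid_add"
  assumes "finite v" "d \<notin> v"
  shows "(\<Sum>h\<in>insert d v \<rightarrow>\<^sub>E A. F h) = (\<Sum>k\<in>v \<rightarrow>\<^sub>E A. \<Sum>x\<in>A. F (k(d := x)))"
proof -
  have "(\<Sum>h\<in>insert d v \<rightarrow>\<^sub>E A. F h) = (\<Sum>(x, k)\<in>A \<times> (v \<rightarrow>\<^sub>E A). F (k(d := x)))"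
    unfolding PiE_insert_eq using assms
    by (subst sum.reindex) (use inj_combinator [of d v "\<lambda>_. A"] in \<open>auto simp: case_prod_unfold\<close>)
  also have "\<dots> = (\<Sum>x\<in>A. \<Sum>k\<in>v \<rightarrow>\<^sub>E A. F (k(d := x)))"
    by (rule sum.cartesian_product [symmetric])
  also have "\<dots> = (\<Sum>k\<in>v \<rightarrow>\<^sub>E A. \<Sum>x\<in>A. F (k(d := x)))"
    by (rule sum.swap)
  finally show ?thesis .
qed

text \<open>The reciprocal of the denominators in the kernel. The exponent is a parameter because
  raising to the power \<open>lam\<close> turns \<open>\<alpha>\<close> into
  \<open>\<alpha> * lam\<close>.\<close>

definition korobov_weight :: "real \<Rightarrow> 'i set \<Rightarrow> ('i \<Rightarrow> int) \<Rightarrow> real"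
  where "korobov_weight a u h = (\<Prod>j\<in>u. real_of_int \<bar>h j\<bar> powr (-a))"

lemma korobov_weight_nonneg: "korobov_weight a u h \<ge> 0"
  by (auto simp: korobov_weight_def intro!: prod_nonneg)

lemma sum_korobov_weight_le:
  assumes "a > 1" "finite A" "0 \<notin> A" "finite u"
  shows "(\<Sum>h\<in>u \<rightarrow>\<^sub>E A. korobov_weight a u h) \<le> (2 * zeta a) ^ card u"
proof -
  have "(\<Sum>h\<in>u \<rightarrow>\<^sub>E A. korobov_weight a u h)
      = (\<Prod>j\<in>u. \<Sum>h\<in>A. real_of_int \<bar>h\<bar> powr (-a))"
    unfolding korobov_weight_def using assms by (subst prod_sum_PiE) auto
  also have "\<dots> \<le> (\<Prod>j\<in>u. 2 * zeta a)"
    using assms by (intro prod_mono conjI sum_nonneg sum_powr_le_zeta) auto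
  finally show ?thesis by simp
qed

text \<open>The search space is the set of totatives of \<open>b ^ (m - w)\<close>, with
  \<open>b ^ (m - w - 1) * (b - 1)\<close> elements, and \<open>2 * (b - 1) \<ge> b\<close>. This
  loss is the source of the factor 2 in the final bound.\<close>

lemma card_search_space_ge:
  assumes "prime b" "w < m"
  shows "2 * card (search_space b m w) \<ge> b ^ (m - w)"
proof -
  let ?M = "b ^ (m - w)"
  have b: "b \<ge> 2" using assms prime_ge_2_nat by blast
  have M: "?M > 1" using b assms by (intro one_less_power) auto
  have "search_space b m w = int ` totatives ?M"
  proof (intro equalityI subsetI)
    fix z assume "z \<in> search_space b m w"
    then have z: "z \<ge> 1" "z < int b ^ (m - w)" "coprime z (int b)"
      using assms by (auto simp: search_space_def coprime_iff_gcd_eq_1 [symmetric] split: if_splits)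
    then obtain n where "z = int n" by (metis nonneg_int_cases zero_le_one order_trans)
    with z assms show "z \<in> int ` totatives ?M"
      by (auto simp: in_totatives_iff simp flip: of_nat_power)
  next
    fix z assume "z \<in> int ` totatives ?M"
    then obtain n where n: "z = int n" "n \<in> totatives ?M" by blast
    \<comment> \<open>As \<open>?M > 1\<close>, the modulus itself is not a totative, which matches
      the upper limit \<open>b ^ (m - w) - 1\<close> of the search space.\<close>
    with M have "n < ?M" using totatives_less by blast
    with n M assms show "z \<in> search_space b m w"
      by (auto simp: search_space_def in_totatives_iff coprime_iff_gcd_eq_1 [symmetric] simp flip: of_nat_power)
  qed
  then have "card (search_space b m w) = totient ?M"
    by (simp add: card_image totient_def)
  also have "\<dots> = b ^ (m - w - 1) * (b - 1)"
    using assms by (subst totient_prime_power) auto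
  finally have "2 * card (search_space b m w) = b ^ (m - w - 1) * (2 * (b - 1))" by simp
  also have "\<dots> \<ge> b ^ (m - w - 1) * b" using b by (intro mult_left_mono) auto
  also have "b ^ (m - w - 1) * b = ?M" using assms by (metis power_minus_mult zero_less_diff)
  finally show ?thesis .
qed

lemma card_search_space_pos:
  assumes "prime b"
  shows "card (search_space b m w) > 0"
proof (cases "w < m")
  case True
  have "b ^ (m - w) > 0" using assms prime_gt_0_nat by auto
  with card_search_space_ge [OF assms True] show ?thesis by linarith
qed (simp add: search_space_def)

text \<open>All coordinates except \<open>d\<close> are frozen in \<open>\<xi>\<close>. For
  \<open>w < m\<close>, division by \<open>b ^ w\<close> leaves a congruence modulo
  \<open>b ^ (m - w)\<close> in the unit \<open>z\<close>, and the size of the search space supplies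
  the denominator. For \<open>w \<ge> m\<close> the denominator is 1 and dropping the congruence is
  enough.\<close>

lemma sum_search_space_le:
  fixes A :: "int set" and \<xi> :: "'i \<Rightarrow> int"
  assumes "prime b" "a > 1" "finite A" "0 \<notin> A" "finite u" "d \<in> u"
  shows "(\<Sum>z\<in>search_space b m w. \<Sum>h\<in>u \<rightarrow>\<^sub>E A.
            if int (b ^ m) dvd (\<Sum>j\<in>u. h j * (\<xi>(d := int b ^ w * z)) j) then korobov_weight a u h else 0)
         \<le> card (search_space b m w) * (2 * (2 * zeta a) ^ card u / real b powr max 0 (real m - real w))"
    (is "?L \<le> _")
proof (cases "w < m")
  case False
  then have "?L \<le> (\<Sum>h\<in>u \<rightarrow>\<^sub>E A. korobov_weight a u h)"
    using korobov_weight_nonneg by (auto simp: search_space_def intro!: sum_mono)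
  also have "\<dots> \<le> (2 * zeta a) ^ card u"
    using assms by (intro sum_korobov_weight_le) auto
  also have "\<dots> \<le> 2 * (2 * zeta a) ^ card u"
    using zeta_nonneg [OF assms(2)] by simp
  finally show ?thesis using False prime_gt_0_nat [OF assms(1)] by (simp add: search_space_def)
next
  case True
  define v where "v = u - {d}"
  have u: "u = insert d v" and v: "finite v" "d \<notin> v" using assms by (auto simp: v_def)
  define M where "M = int b ^ (m - w)"
  have b0: "b > 0" using prime_gt_0_nat [OF assms(1)] .
  have M: "M > 0" using b0 by (simp add: M_def)
  have N: "int (b ^ m) = int b ^ w * M" using True by (simp add: M_def flip: power_add)
  have Z: "search_space b m w \<subseteq> {0..<M}" "\<And>z. z \<in> search_space b m w \<Longrightarrow> coprime z M"
    using True by (auto simp: search_space_def M_def coprime_iff_gcd_eq_1 [symmetric])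
  \<comment> \<open>\<open>C\<close> stands for the part of the inner product that comes from the
    coordinates other than \<open>d\<close>.\<close>
  have inner: "(\<Sum>z\<in>search_space b m w. \<Sum>x\<in>A.
       if int (b ^ m) dvd C + x * (int b ^ w * z) then real_of_int \<bar>x\<bar> powr (-a) else 0) \<le> 2 * zeta a"
    for C
  proof (cases "int b ^ w dvd C")
    case False
    \<comment> \<open>\<open>b ^ w\<close> divides both \<open>b ^ m\<close> and the term of
      coordinate \<open>d\<close>, so it would have to divide \<open>C\<close>.\<close>
    then have "\<not> int (b ^ m) dvd C + x * (int b ^ w * z)" for x z
      unfolding N by (metis dvd_add_left_iff dvd_mult_left dvd_triv_left dvd_mult)
    then show ?thesis using zeta_nonneg [OF assms(2)] by simp
  next
    case True
    then obtain c where c: "C = int b ^ w * c" by blast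
    have "int (b ^ m) dvd C + x * (int b ^ w * z) \<longleftrightarrow> M dvd x * z + c" for x z
    proof -
      have "C + x * (int b ^ w * z) = int b ^ w * (x * z + c)" by (simp add: c algebra_simps)
      then show ?thesis unfolding N using b0 by simp
    qed
    then show ?thesis
      using sum_units_congruence_le [OF assms(2,3,4) M Z] by simp
  qed
  have "?L = (\<Sum>z\<in>search_space b m w. \<Sum>k\<in>v \<rightarrow>\<^sub>E A. \<Sum>x\<in>A. korobov_weight a v k *
       (if int (b ^ m) dvd (\<Sum>j\<in>v. k j * \<xi> j) + x * (int b ^ w * z) then real_of_int \<bar>x\<bar> powr (-a) else 0))"
  proof -
    have *: "(\<Sum>j\<in>v. (k(d := x)) j * (\<xi>(d := y)) j) = (\<Sum>j\<in>v. k j * \<xi> j)" for k x y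
      using v by (intro sum.cong) auto
    have **: "korobov_weight a v (k(d := x)) = korobov_weight a v k" for k x
      unfolding korobov_weight_def using v by (intro prod.cong) auto
    have ***: "korobov_weight a (insert d v) k = real_of_int \<bar>k d\<bar> powr (-a) * korobov_weight a v k" for k
      unfolding korobov_weight_def using v by simp
    show ?thesis
      unfolding u sum_PiE_insert [OF v]
      using v by (intro sum.cong refl) (simp add: * ** *** add.commute [of "x * y" for x y] del: fun_upd_apply, simp)
  qed
  also have "\<dots> = (\<Sum>k\<in>v \<rightarrow>\<^sub>E A. korobov_weight a v k * (\<Sum>z\<in>search_space b m w. \<Sum>x\<in>A. 
       (if int (b ^ m) dvd (\<Sum>j\<in>v. k j * \<xi> j) + x * (int b ^ w * z) then real_of_int \<bar>x\<bar> powr (-a) else 0)))"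
    by (subst sum.swap) (simp add: sum_distrib_left)
  also have "\<dots> \<le> (\<Sum>k\<in>v \<rightarrow>\<^sub>E A. korobov_weight a v k * (2 * zeta a))"
    by (intro sum_mono mult_left_mono inner korobov_weight_nonneg)
  also have "\<dots> \<le> (2 * zeta a) ^ card v * (2 * zeta a)"
    unfolding sum_distrib_right [symmetric]
    using zeta_nonneg [OF assms(2)] assms v by (intro mult_right_mono sum_korobov_weight_le) auto
  also have "\<dots> = (2 * zeta a) ^ card u" using v by (simp add: u)
  \<comment> \<open>The new factor is at least 1 by \<open>card_search_space_ge\<close>; it recasts
    the bound as cardinality times mean.\<close>
  also have "\<dots> \<le> (2 * real (card (search_space b m w)) / b ^ (m - w)) * (2 * zeta a) ^ card u"
  proof -
    have "real b ^ (m - w) \<le> 2 * real (card (search_space b m w))"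
      using card_search_space_ge [OF assms(1) True]
      by (metis of_nat_le_iff of_nat_mult of_nat_numeral of_nat_power)
    then have "1 \<le> 2 * real (card (search_space b m w)) / b ^ (m - w)"
      using b0 by (simp add: field_simps)
    then show ?thesis
      using zeta_nonneg [OF assms(2)] by (metis mult_le_cancel_right1 not_less zero_le_mult_iff zero_le_numeral zero_le_power)
  qed
  finally show ?thesis
    using True b0 by (simp add: powr_realpow [symmetric] of_nat_diff mult_ac)
qed

section \<open>Infinite sums over tuples of nonzero integers\<close>

lemma has_sum_sum:
  fixes f :: "'i \<Rightarrow> 'a \<Rightarrow> 'b::topological_comm_monoid_add"
  assumes "\<And>i. i \<in> I \<Longrightarrow> (f i has_sum s i) A"
  shows "((\<lambda>x. \<Sum>i\<in>I. f i x) has_sum (\<Sum>i\<in>I. s i)) A"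
  using assms
proof (induction I rule: infinite_finite_induct)
  case (insert i I)
  then have "((\<lambda>x. f i x + (\<Sum>i\<in>I. f i x)) has_sum (s i + (\<Sum>i\<in>I. s i))) A"
    by (intro has_sum_add) simp_all
  with insert.hyps show ?case by simp
qed simp_all

text \<open>\<open>A\<close> collects all coordinate values of the tuples in \<open>F\<close>.
  Finite partial sums can thus be enlarged to boxes, on which sums of product weights
  factor.\<close>

lemma finite_subset_PiE:
  assumes "finite F" "finite u" "F \<subseteq> u \<rightarrow>\<^sub>E (UNIV - {x})"
  obtains A where "finite A" "x \<notin> A" "F \<subseteq> u \<rightarrow>\<^sub>E A"
proof
  show "finite (\<Union>h\<in>F. h ` u)" using assms by auto
  show "x \<notin> (\<Union>h\<in>F. h ` u)"
  proof
    assume "x \<in> (\<Union>h\<in>F. h ` u)"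
    then obtain h j where h: "h \<in> F" "j \<in> u" "x = h j" by auto
    with assms(3) have "h j \<in> UNIV - {x}" by (intro PiE_mem [of h u "\<lambda>_. UNIV - {x}"]) auto
    with h show False by simp
  qed
  show "F \<subseteq> u \<rightarrow>\<^sub>E (\<Union>h\<in>F. h ` u)"
  proof
    fix h assume "h \<in> F"
    with assms(3) have "h \<in> extensional u" by (auto simp: PiE_def)
    with \<open>h \<in> F\<close> show "h \<in> u \<rightarrow>\<^sub>E (\<Union>h\<in>F. h ` u)" by (auto simp: PiE_iff)
  qed
qed

text \<open>Every finite partial sum is at most a sum over a box, which is at most
  \<open>(2 * zeta a) ^ card u\<close> whatever the box.\<close>

lemma korobov_weight_summable:
  assumes "a > 1" "finite u"
  shows "korobov_weight a u summable_on (u \<rightarrow>\<^sub>E (UNIV - {0}))"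
proof (rule nonneg_bdd_above_summable_on)
  show "bdd_above (sum (korobov_weight a u) ` {F. F \<subseteq> u \<rightarrow>\<^sub>E (UNIV - {0}) \<and> finite F})"
  proof (rule bdd_aboveI2)
    fix F :: "('a \<Rightarrow> int) set"
    assume "F \<in> {F. F \<subseteq> u \<rightarrow>\<^sub>E (UNIV - {0}) \<and> finite F}"
    then have F: "finite F" "F \<subseteq> u \<rightarrow>\<^sub>E (UNIV - {0})" by auto
    obtain A where A: "finite A" "0 \<notin> A" "F \<subseteq> u \<rightarrow>\<^sub>E A"
      using finite_subset_PiE [OF F(1) assms(2) F(2)] .
    have "sum (korobov_weight a u) F \<le> (\<Sum>h\<in>u \<rightarrow>\<^sub>E A. korobov_weight a u h)"
      using A assms by (intro sum_mono2 korobov_weight_nonneg finite_PiE)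
    also have "\<dots> \<le> (2 * zeta a) ^ card u"
      using A assms by (intro sum_korobov_weight_le)
    finally show "sum (korobov_weight a u) F \<le> (2 * zeta a) ^ card u" .
  qed
qed (rule korobov_weight_nonneg)

section \<open>Riesz representation\<close>

context function_hilbert_space
begin

lemma diff_closed: "f \<in> H \<Longrightarrow> g \<in> H \<Longrightarrow> (\<lambda>x. f x - g x) \<in> H"
  using add_closed [OF _ scale_closed [of g "-1"], of f] by simp

lemma sum_closed: "(\<And>i. i \<in> A \<Longrightarrow> f i \<in> H) \<Longrightarrow> (\<lambda>x. \<Sum>i\<in>A. f i x) \<in> H"
  by (induction A rule: infinite_finite_induct) (auto simp: zero_closed intro: add_closed)

lemma ip_diff: "f \<in> H \<Longrightarrow> g \<in> H \<Longrightarrow> h \<in> H \<Longrightarrow> ip (\<lambda>x. f x - g x) h = ip f h - ip g h"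
  using ip_add [OF _ scale_closed [of g "-1"], of f h] ip_scale [of g h "-1"] by simp

lemma ip_zero: "h \<in> H \<Longrightarrow> ip (\<lambda>x. 0) h = 0"
  using ip_scale [of h h 0] by simp

lemma ip_sum: "(\<And>i. i \<in> A \<Longrightarrow> f i \<in> H) \<Longrightarrow> h \<in> H \<Longrightarrow> ip (\<lambda>x. \<Sum>i\<in>A. f i x) h = (\<Sum>i\<in>A. ip (f i) h)"
  by (induction A rule: infinite_finite_induct) (auto simp: ip_zero ip_add sum_closed)

lemma ip_add_right: "f \<in> H \<Longrightarrow> g \<in> H \<Longrightarrow> h \<in> H \<Longrightarrow> ip h (\<lambda>x. f x + g x) = ip h f + ip h g"
  using ip_commute [of "\<lambda>x. f x + g x" h] ip_commute [of f h] ip_commute [of g h]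
  by (simp add: add_closed ip_add)

lemma ip_diff_right: "f \<in> H \<Longrightarrow> g \<in> H \<Longrightarrow> h \<in> H \<Longrightarrow> ip h (\<lambda>x. f x - g x) = ip h f - ip h g"
  using ip_commute [of "\<lambda>x. f x - g x" h] ip_commute [of f h] ip_commute [of g h]
  by (simp add: diff_closed ip_diff)

lemma ip_scale_right: "f \<in> H \<Longrightarrow> h \<in> H \<Longrightarrow> ip h (\<lambda>x. c * f x) = cnj c * ip h f"
  using ip_commute [of "\<lambda>x. c * f x" h] ip_commute [of f h]
  by (simp add: scale_closed ip_scale)

lemma ip_self: "f \<in> H \<Longrightarrow> ip f f = of_real ((ip_norm ip f)\<^sup>2)"
  using ip_nonneg [of f] ip_commute [of f f] by (simp add: ip_norm_def complex_eq_iff)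

lemma ip_norm_nonneg: "f \<in> H \<Longrightarrow> ip_norm ip f \<ge> 0"
  using ip_nonneg [of f] by (simp add: ip_norm_def)

lemma ip_norm_eq_0: "f \<in> H \<Longrightarrow> ip_norm ip f = 0 \<Longrightarrow> f = (\<lambda>x. 0)"
  using ip_definite [of f] by (simp add: ip_self)

lemma ip_norm_scale: "f \<in> H \<Longrightarrow> ip_norm ip (\<lambda>x. c * f x) = cmod c * ip_norm ip f"
proof -
  assume f: "f \<in> H"
  have "ip (\<lambda>x. c * f x) (\<lambda>x. c * f x) = of_real ((cmod c)\<^sup>2 * (ip_norm ip f)\<^sup>2)"
    using f by (simp add: ip_scale ip_scale_right scale_closed ip_self complex_norm_square ac_simps del: of_real_power)
  then show ?thesis
    using ip_norm_nonneg [OF f] by (simp add: ip_norm_def [of ip "\<lambda>x. c * f x"] real_sqrt_mult)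
qed

lemma ip_norm_square_add:
  assumes "f \<in> H" "g \<in> H"
  shows "(ip_norm ip (\<lambda>x. f x + g x))\<^sup>2 = (ip_norm ip f)\<^sup>2 + 2 * Re (ip f g) + (ip_norm ip g)\<^sup>2"
proof -
  have "complex_of_real ((ip_norm ip (\<lambda>x. f x + g x))\<^sup>2) = ip f f + (ip f g + cnj (ip f g)) + ip g g"
    using assms ip_commute [of f g]
    by (subst ip_self [symmetric]) (auto simp: add_closed ip_add ip_add_right)
  also have "ip f g + cnj (ip f g) = of_real (2 * Re (ip f g))"
    by (simp add: complex_eq_iff)
  also have "ip f f + \<dots> + ip g g = of_real ((ip_norm ip f)\<^sup>2 + 2 * Re (ip f g) + (ip_norm ip g)\<^sup>2)"
    using assms by (simp add: ip_self)
  finally show ?thesis by (simp only: of_real_eq_iff)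
qed

lemma ip_norm_square_diff:
  assumes "f \<in> H" "g \<in> H"
  shows "(ip_norm ip (\<lambda>x. f x - g x))\<^sup>2 = (ip_norm ip f)\<^sup>2 - 2 * Re (ip f g) + (ip_norm ip g)\<^sup>2"
  using ip_norm_square_add [OF assms(1) scale_closed [OF assms(2), of "-1"]]
    ip_norm_scale [OF assms(2), of "-1"] ip_scale_right [OF assms(2,1), of "-1"]
  by simp

lemma ip_Cauchy_Schwarz:
  assumes "f \<in> H" "g \<in> H"
  shows "cmod (ip f g) \<le> ip_norm ip f * ip_norm ip g"
proof (cases "ip_norm ip g = 0")
  case True
  with assms have "g = (\<lambda>x. 0)" using ip_norm_eq_0 by blast
  then have "ip f g = 0"
    using assms ip_commute [of "\<lambda>x. 0" f] by (simp add: zero_closed ip_zero)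
  then show ?thesis using True by simp
next
  case False
  \<comment> \<open>\<open>t * g\<close> is the orthogonal projection of \<open>f\<close> onto the
    line spanned by \<open>g\<close>; the inequality says that the remainder has nonnegative squared
    norm.\<close>
  define t where "t = ip f g / of_real ((ip_norm ip g)\<^sup>2)"
  let ?n = "ip_norm ip g"
  have n: "?n > 0" using False ip_norm_nonneg [OF assms(2)] by simp
  have "0 \<le> (ip_norm ip (\<lambda>x. f x - t * g x))\<^sup>2" by simp
  also have "\<dots> = (ip_norm ip f)\<^sup>2 - 2 * Re (cnj t * ip f g) + (cmod t * ?n)\<^sup>2"
    using assms by (subst ip_norm_square_diff) (auto simp: scale_closed ip_scale_right ip_norm_scale)
  also have "cnj t * ip f g = of_real ((cmod (ip f g))\<^sup>2 / ?n\<^sup>2)"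
    by (simp add: t_def complex_norm_square del: of_real_power)
  also have "Re (of_real ((cmod (ip f g))\<^sup>2 / ?n\<^sup>2)) = (cmod (ip f g))\<^sup>2 / ?n\<^sup>2" by simp
  also have "cmod t * ?n = cmod (ip f g) / ?n"
    using n by (simp add: t_def norm_divide power2_eq_square norm_mult)
  finally have "(cmod (ip f g))\<^sup>2 \<le> (ip_norm ip f * ?n)\<^sup>2"
    using n by (simp add: power_divide field_simps power_mult_distrib)
  then show ?thesis
    using n ip_norm_nonneg [OF assms(1)] by (simp add: power2_le_iff_abs_le)
qed

text \<open>The representer is the minimizer of \<open>\<parallel>f\<parallel>\<^sup>2 - 2 Re (L f)\<close>; minimizing sequences are Cauchy
  by the parallelogram law.\<close>

theorem Riesz_representation:
  fixes L :: "('a \<Rightarrow> complex) \<Rightarrow> complex"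
  assumes L_add: "\<And>f g. f \<in> H \<Longrightarrow> g \<in> H \<Longrightarrow> L (\<lambda>x. f x + g x) = L f + L g"
    and L_scale: "\<And>f c. f \<in> H \<Longrightarrow> L (\<lambda>x. c * f x) = c * L f"
    and L_bound: "\<And>f. f \<in> H \<Longrightarrow> cmod (L f) \<le> C * ip_norm ip f"
  shows "\<exists>g\<in>H. \<forall>f\<in>H. L f = ip f g"
proof -
  let ?n = "ip_norm ip"
  have L_diff: "L (\<lambda>x. f x - g x) = L f - L g" if "f \<in> H" "g \<in> H" for f g
    using L_add [OF that(1) scale_closed [OF that(2), of "-1"]] L_scale [OF that(2), of "-1"] by simp
  define J where "J f = (?n f)\<^sup>2 - 2 * Re (L f)" for f
  define \<mu> where "\<mu> = Inf (J ` H)"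
  have lower: "J f \<ge> - C\<^sup>2" if "f \<in> H" for f
  proof -
    have "Re (L f) \<le> C * ?n f" using L_bound [OF that] complex_Re_le_cmod order_trans by blast
    \<comment> \<open>Completing the square in \<open>?n f\<close>.\<close>
    then have "J f \<ge> (?n f - C)\<^sup>2 - C\<^sup>2" by (simp add: J_def power2_diff mult.commute)
    then show ?thesis using zero_le_power2 [of "?n f - C"] by linarith
  qed
  have bdd: "bdd_below (J ` H)" using lower by (intro bdd_belowI2) auto
  have \<mu>: "\<mu> \<le> J f" if "f \<in> H" for f unfolding \<mu>_def using that by (intro cInf_lower bdd) auto
  have "\<exists>f\<in>H. J f < \<mu> + 1 / real (Suc n)" for n
  proof -
    have "\<exists>x\<in>J ` H. x < \<mu> + 1 / real (Suc n)"
      unfolding \<mu>_def using zero_closed by (subst cInf_less_iff [OF _ bdd, symmetric]) auto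
    then show ?thesis by blast
  qed
  then obtain F where F: "\<And>n. F n \<in> H" "\<And>n. J (F n) < \<mu> + 1 / real (Suc n)" by metis
  have par: "(?n (\<lambda>x. f x - g x))\<^sup>2 \<le> 2 * (J f + J g - 2 * \<mu>)" if fg: "f \<in> H" "g \<in> H" for f g
  proof -
    \<comment> \<open>The midpoint of \<open>f\<close> and \<open>g\<close> competes in the infimum
      too, so \<open>\<mu> \<le> J ?h\<close>; the parallelogram law converts this into a bound on
      the distance of \<open>f\<close> and \<open>g\<close>.\<close>
    let ?h = "\<lambda>x. (1/2) * (f x + g x)"
    have h: "?h \<in> H" using fg by (intro scale_closed add_closed)
    have Lh: "L ?h = (1/2) * (L f + L g)" 
      by (simp only: L_scale [OF add_closed [OF fg]] L_add [OF fg])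
    have nh: "?n ?h = 1/2 * ?n (\<lambda>x. f x + g x)"
      using ip_norm_scale [OF add_closed [OF fg], of "1/2"] by simp
    have "4 * J ?h = (?n (\<lambda>x. f x + g x))\<^sup>2 - 4 * (Re (L f) + Re (L g))"
    proof -
      have "4 * (2 * Re (L ?h)) = 4 * (Re (L f) + Re (L g))" unfolding Lh by simp
      moreover have "4 * (?n ?h)\<^sup>2 = (?n (\<lambda>x. f x + g x))\<^sup>2" unfolding nh by (simp add: power_divide)
      ultimately show ?thesis unfolding J_def right_diff_distrib by simp
    qed
    then have "4 * \<mu> \<le> (?n (\<lambda>x. f x + g x))\<^sup>2 - 4 * (Re (L f) + Re (L g))"
      using \<mu> [OF h] by linarith
    then show ?thesis
      unfolding ip_norm_square_add [OF fg] ip_norm_square_diff [OF fg] J_def by (simp add: algebra_simps)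
  qed
  have "\<exists>M. \<forall>k\<ge>M. \<forall>n\<ge>M. ?n (\<lambda>x. F k x - F n x) < e" if "e > 0" for e
  proof -
    \<comment> \<open>Two late members of the sequence exceed \<open>\<mu>\<close> by less than
      \<open>1 / real (Suc M)\<close> each, and \<open>par\<close> doubles the total, hence the
      4.\<close>
    obtain M where M: "4 / real (Suc M) < e\<^sup>2"
    proof -
      obtain M where "4 / e\<^sup>2 < real M" using reals_Archimedean2 by blast
      then have "4 / e\<^sup>2 < real (Suc M)" by simp
      then show ?thesis using that \<open>e > 0\<close> by (simp add: field_simps)
    qed
    have "?n (\<lambda>x. F k x - F n x) < e" if "k \<ge> M" "n \<ge> M" for k n
    proof -
      have "1 / real (Suc k) \<le> 1 / real (Suc M)" "1 / real (Suc n) \<le> 1 / real (Suc M)"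
        using that by (auto intro!: divide_left_mono)
      then have "J (F k) + J (F n) - 2 * \<mu> < 2 / real (Suc M)"
        using F(2) [of k] F(2) [of n] by simp
      then have "(?n (\<lambda>x. F k x - F n x))\<^sup>2 < e\<^sup>2"
        using par [OF F(1) F(1), of k n] M by simp
      then show ?thesis using \<open>e > 0\<close> by (simp add: power_less_imp_less_base)
    qed
    then show ?thesis by blast
  qed
  then have "\<exists>g\<in>H. (\<lambda>n. ?n (\<lambda>x. F n x - g x)) \<longlonglongrightarrow> 0"
    by (rule complete [OF F(1)])
  then obtain g where g: "g \<in> H" "(\<lambda>n. ?n (\<lambda>x. F n x - g x)) \<longlonglongrightarrow> 0"
    by blast
  have "(\<lambda>n. J (F n)) \<longlonglongrightarrow> J g"
  proof -
    let ?d = "\<lambda>n x. F n x - g x"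
    have d: "?d n \<in> H" for n using F g by (intro diff_closed)
    \<comment> \<open>Expansion about the limit \<open>g\<close>; each correction is controlled by
      the norm of \<open>?d n\<close>.\<close>
    have J: "J (F n) = J g + ((?n (?d n))\<^sup>2 + 2 * Re (ip (?d n) g) - 2 * Re (L (?d n)))" for n
      using ip_norm_square_add [OF d [of n] g(1)] L_diff [OF F(1) g(1), of n] by (simp add: J_def)
    have "(\<lambda>n. ip (?d n) g) \<longlonglongrightarrow> 0"
      by (rule Lim_null_comparison [OF _ tendsto_mult_left_zero [OF g(2), of "?n g"]])
        (auto intro!: always_eventually ip_Cauchy_Schwarz d g)
    moreover have "(\<lambda>n. L (?d n)) \<longlonglongrightarrow> 0"
      by (rule Lim_null_comparison [OF _ tendsto_mult_right_zero [OF g(2), of C]])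
        (auto intro!: always_eventually L_bound d)
    ultimately have "(\<lambda>n. J g + ((?n (?d n))\<^sup>2 + 2 * Re (ip (?d n) g) - 2 * Re (L (?d n))))
        \<longlonglongrightarrow> J g + (0\<^sup>2 + 2 * Re 0 - 2 * Re 0)"
      using g(2) by (intro tendsto_intros)
    then show ?thesis unfolding J by simp
  qed
  moreover have "(\<lambda>n. J (F n)) \<longlonglongrightarrow> \<mu>"
  proof (rule tendsto_sandwich [of "\<lambda>_. \<mu>" _ _ "\<lambda>n. \<mu> + 1 / real (Suc n)"])
    show "(\<lambda>n. \<mu> + 1 / real (Suc n)) \<longlonglongrightarrow> \<mu>"
      using tendsto_add [OF tendsto_const LIMSEQ_inverse_real_of_nat, of \<mu>] by (simp add: inverse_eq_divide)
  qed (use F \<mu> in \<open>auto intro!: always_eventually less_imp_le simp del: of_nat_Suc\<close>)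
  ultimately have "J g = \<mu>" by (rule LIMSEQ_unique)
  have Re_eq: "Re (L f) = Re (ip f g)" if f: "f \<in> H" for f
  proof -
    define r where "r = Re (ip f g) - Re (L f)"
    \<comment> \<open>Moving from the minimizer \<open>g\<close> along \<open>f\<close> cannot lower
      \<open>J\<close>, so this quadratic in \<open>t\<close> is nonnegative; its linear coefficient
      must therefore vanish.\<close>
    have key: "0 \<le> t\<^sup>2 * (?n f)\<^sup>2 + 2 * t * r" for t :: real
    proof -
      let ?h = "\<lambda>x. of_real t * f x"
      have h: "?h \<in> H" using f by (rule scale_closed)
      have "J (\<lambda>x. ?h x + g x) = J g + (t\<^sup>2 * (?n f)\<^sup>2 + 2 * t * r)"
        unfolding J_def ip_norm_square_add [OF h g(1)] L_add [OF h g(1)] L_scale [OF f] ip_norm_scale [OF f]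
          ip_scale [OF f g(1)]
        by (simp add: r_def power_mult_distrib algebra_simps)
      then show ?thesis using \<mu> [OF add_closed [OF h g(1)]] \<open>J g = \<mu>\<close> by linarith
    qed
    have "r = 0"
    proof (rule ccontr)
      assume "r \<noteq> 0"
      \<comment> \<open>The added 1 keeps \<open>s\<close> positive even if \<open>f\<close> has
        norm 0; then \<open>t = - r / s\<close> makes the quadratic negative.\<close>
      define s where "s = (?n f)\<^sup>2 + 1"
      have s: "s > 0" "s > (?n f)\<^sup>2" by (auto simp: s_def add_pos_nonneg add_nonneg_pos)
      have "(- r / s)\<^sup>2 * (?n f)\<^sup>2 + 2 * (- r / s) * r = (r\<^sup>2 / s) * ((?n f)\<^sup>2 / s - 2)"
        using s by (simp add: field_simps power2_eq_square)
      moreover have "\<dots> < 0"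
        using s \<open>r \<noteq> 0\<close> by (intro mult_pos_neg) (auto simp: field_simps)
      ultimately show False using key [of "- r / s"] by linarith
    qed
    then show ?thesis by (simp add: r_def)
  qed
  have "L f = ip f g" if f: "f \<in> H" for f
  proof -
    \<comment> \<open>Multiplication by \<open>- \<i>\<close> turns imaginary parts into real parts,
      so the identity for real parts also yields the one for imaginary parts.\<close>
    have "Re (- \<i> * L f) = Re (- \<i> * ip f g)"
      using Re_eq [OF scale_closed [OF f, of "- \<i>"]] by (simp only: L_scale [OF f] ip_scale [OF f g(1)])
    then show ?thesis using Re_eq [OF f] by (simp add: complex_eq_iff)
  qed
  then show ?thesis using g(1) by blast
qed

text \<open>Cauchy-Schwarz gives the upper bound. It is attained at \<open>g\<close> divided by its
  norm, or at \<open>g\<close> itself if that norm is 0.\<close>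

lemma Sup_representer:
  assumes g: "g \<in> H"
  shows "(SUP f\<in>{f \<in> H. ip_norm ip f \<le> 1}. cmod (ip f g)) = ip_norm ip g"
proof (rule cSup_eq_maximum)
  show "ip_norm ip g \<in> (\<lambda>f. cmod (ip f g)) ` {f \<in> H. ip_norm ip f \<le> 1}"
  proof (cases "ip_norm ip g = 0")
    case True
    then show ?thesis
      using g ip_self [OF g] by (intro image_eqI [of _ _ g]) auto
  next
    case False
    let ?f = "\<lambda>x. of_real (1 / ip_norm ip g) * g x"
    have "ip_norm ip ?f = 1" 
      using False g ip_norm_nonneg [OF g] by (subst ip_norm_scale) (auto simp: norm_divide)
    moreover have "cmod (ip ?f g) = ip_norm ip g"
      using False g ip_norm_nonneg [OF g]
      by (subst ip_scale) (auto simp: ip_self norm_mult norm_divide norm_power power2_eq_square)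
    ultimately show ?thesis
      using scale_closed [OF g, of "of_real (1 / ip_norm ip g)"] by (intro image_eqI [of _ _ ?f]) auto
  qed
next
  fix x assume "x \<in> (\<lambda>f. cmod (ip f g)) ` {f \<in> H. ip_norm ip f \<le> 1}"
  then obtain f where f: "f \<in> H" "ip_norm ip f \<le> 1" "x = cmod (ip f g)" by blast
  have "x \<le> ip_norm ip f * ip_norm ip g" using f g ip_Cauchy_Schwarz by simp
  also have "\<dots> \<le> 1 * ip_norm ip g" using f g ip_norm_nonneg by (intro mult_right_mono) auto
  finally show "x \<le> ip_norm ip g" by simp
qed

end

section \<open>Integration over the unit cube\<close>

text \<open>Closedness is meant in the product topology on all of
  \<open>nat \<Rightarrow> real\<close>: the coordinates outside \<open>{1..s}\<close> are pinned to
  \<open>undefined\<close>, again a closed condition.\<close>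

lemma closed_unit_cube: "closed (unit_cube s)"
proof -
  have "unit_cube s = (\<Inter>j\<in>{1..s}. {x. 0 \<le> x j} \<inter> {x. x j \<le> 1}) \<inter> (\<Inter>j\<in>-{1..s}. {x. x j = undefined})"
    by (auto simp: unit_cube_def PiE_iff extensional_def)
  also have "closed \<dots>"
    by (intro closed_Int closed_INT ballI closed_Collect_le closed_Collect_eq continuous_intros
        continuous_on_product_coordinates)
  finally show ?thesis .
qed

interpretation lborel_product: product_sigma_finite "\<lambda>_::nat. lborel :: real measure"
  by standard

lemma unit_cube_sets: "unit_cube s \<in> sets (PiM {1..s} (\<lambda>_. lborel))"
  unfolding unit_cube_def by (intro sets_PiM_I_finite) auto

lemma emeasure_unit_cube: "emeasure (PiM {1..s} (\<lambda>_. lborel)) (unit_cube s) = 1"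
  unfolding unit_cube_def by (subst lborel_product.emeasure_PiM) auto

lemma integral_unit_cube_1: "(LINT x:unit_cube s|PiM {1..s} (\<lambda>_. lborel). 1 :: complex) = 1"
  using unit_cube_sets [of s] emeasure_unit_cube [of s]
  by (simp add: set_lebesgue_integral_def measure_def)

text \<open>Continuity refers to the product topology on the whole function type, measurability to
  the finite product measure. The identity map links them, since coordinates outside
  \<open>{1..s}\<close> are constant on the space of the measure.\<close>

lemma continuous_on_cube_measurable:
  fixes f :: "(nat \<Rightarrow> real) \<Rightarrow> complex"
  assumes "continuous_on (unit_cube s) f"
  shows "set_borel_measurable (PiM {1..s} (\<lambda>_. lborel)) (unit_cube s) f"
proof -
  have "(\<lambda>x. x) \<in> borel_measurable (PiM {1..s} (\<lambda>_. lborel :: real measure))"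
  proof (rule measurable_coordinatewise_then_product)
    fix i show "(\<lambda>x. x i) \<in> borel_measurable (PiM {1..s} (\<lambda>_. lborel :: real measure))"
    proof (cases "i \<in> {1..s}")
      case False
      then have "x i = undefined" if "x \<in> space (PiM {1..s} (\<lambda>_. lborel :: real measure))" for x
        using that by (auto simp: space_PiM PiE_iff extensional_def)
      then show ?thesis by (subst measurable_cong [of _ _ "\<lambda>_. undefined"]) auto
    qed measurable
  qed
  moreover have "(\<lambda>x. indicator (unit_cube s) x *\<^sub>R f x) \<in> borel_measurable borel"
    using closed_unit_cube assms by (intro borel_measurable_continuous_on_indicator) auto
  ultimately show ?thesis
    unfolding set_borel_measurable_def by (rule measurable_compose)
qed

text \<open>The cube has measure 1, so boundedness gives integrability and \<open>B\<close> passes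
  unchanged to the integral.\<close>

lemma continuous_on_cube_integral:
  fixes f :: "(nat \<Rightarrow> real) \<Rightarrow> complex"
  assumes "continuous_on (unit_cube s) f" and B: "\<And>x. x \<in> unit_cube s \<Longrightarrow> cmod (f x) \<le> B"
  shows "set_integrable (PiM {1..s} (\<lambda>_. lborel)) (unit_cube s) f" (is ?int)
    and "cmod (LINT x:unit_cube s|PiM {1..s} (\<lambda>_. lborel). f x) \<le> B"
proof -
  let ?M = "PiM {1..s} (\<lambda>_. lborel :: real measure)"
  have const: "set_integrable ?M (unit_cube s) (\<lambda>_. B)"
    unfolding set_integrable_def using unit_cube_sets [of s] emeasure_unit_cube [of s]
    by (intro integrable_scaleR_left) (simp add: integrable_indicator_iff)
  show int: ?int
    using B by (intro set_integrable_bound [OF const continuous_on_cube_measurable [OF assms(1)]])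
      (force intro!: AE_I2)
  have "cmod (LINT x:unit_cube s|?M. f x) \<le> (LINT x:unit_cube s|?M. cmod (f x))"
    using int by (rule set_integral_norm_bound)
  also have "\<dots> \<le> (LINT x:unit_cube s|?M. B)"
    using int const B by (intro set_integral_mono set_integrable_norm) auto
  also have "\<dots> = B"
    using unit_cube_sets [of s] emeasure_unit_cube [of s]
    by (simp add: set_lebesgue_integral_def measure_def)
  finally show "cmod (LINT x:unit_cube s|?M. f x) \<le> B" .
qed

text \<open>The antiderivative takes equal values at 0 and 1, because \<open>exp\<close> has period
  \<open>2 * pi * \<i>\<close> and \<open>k\<close> is an integer.\<close>

lemma integral_unit_interval_exp:
  fixes k :: int and y :: real
  assumes "k \<noteq> 0"
  shows "(LINT t|lborel. indicator {0..1} t *\<^sub>R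
            exp (2 * complex_of_real pi * \<i> * complex_of_real (real_of_int k * (t - y)))) = 0"
proof -
  let ?c = "2 * complex_of_real pi * \<i> * of_int k"
  let ?f = "\<lambda>t. exp (2 * complex_of_real pi * \<i> * complex_of_real (real_of_int k * (t - y)))"
  have c: "?c \<noteq> 0" using assms by simp
  have "((\<lambda>t. ?f t / ?c) has_vector_derivative ?f t) (at t within {0..1})" for t
  proof -
    have "((\<lambda>z. exp (?c * (z - of_real y)) / ?c) has_field_derivative exp (?c * (of_real t - of_real y)))
        (at (of_real t))"
      using c by (auto intro!: derivative_eq_intros)
    then have "((\<lambda>z. exp (?c * (of_real z - of_real y)) / ?c) has_vector_derivative exp (?c * (of_real t - of_real y)))
        (at t within {0..1})"
      by (rule has_vector_derivative_real_field [THEN has_vector_derivative_at_within])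
    then show ?thesis by (simp add: mult.assoc)
  qed
  then have "(LINT t|lborel. indicator {0..1} t *\<^sub>R ?f t) = ?f 1 / ?c - ?f 0 / ?c"
    by (intro integral_FTC_Icc continuous_intros) auto
  also have "?f 1 = ?f 0 * exp (2 * complex_of_real pi * \<i> * of_int k)"
    unfolding exp_add [symmetric] by (rule arg_cong [of _ _ exp]) (simp add: algebra_simps)
  also have "exp (2 * complex_of_real pi * \<i> * of_int k) = 1"
    using exp_integer_2pi [of "of_int k"] by (simp add: mult_ac)
  finally show ?thesis by simp
qed

section \<open>The kernel\<close>

text \<open>One Fourier mode of the kernel. Its modulus is exactly the weight, so the weights form a
  summable majorant independent of the points.\<close>

definition korobov_term ::
    "real \<Rightarrow> nat set \<Rightarrow> (nat \<Rightarrow> real) \<Rightarrow> (nat \<Rightarrow> real) \<Rightarrow> (nat \<Rightarrow> int) \<Rightarrow> complex"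
  where "korobov_term \<alpha> u x y h =
    exp (2 * complex_of_real pi * \<i> * complex_of_real (\<Sum>j\<in>u. real_of_int (h j) * (x j - y j))) *
    complex_of_real (korobov_weight \<alpha> u h)"

lemma korobov_kernel_eq:
  "korobov_kernel s \<alpha> \<gamma> x y =
    1 + (\<Sum>u\<in>Pow {1..s} - {{}}. complex_of_real (\<gamma> u) *
          (\<Sum>\<^sub>\<infinity>h\<in>u \<rightarrow>\<^sub>E (UNIV - {0}). korobov_term \<alpha> u x y h))"
proof -
  have "korobov_weight \<alpha> u h = inverse (\<Prod>j\<in>u. real_of_int \<bar>h j\<bar> powr \<alpha>)" for u and h :: "nat \<Rightarrow> int"
    unfolding korobov_weight_def powr_minus by (rule prod_inversef [unfolded o_def])
  then have "korobov_term \<alpha> u x y h =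
      exp (2 * complex_of_real pi * \<i> * complex_of_real (\<Sum>j\<in>u. real_of_int (h j) * (x j - y j))) /
      complex_of_real (\<Prod>j\<in>u. real_of_int \<bar>h j\<bar> powr \<alpha>)" for u h
    unfolding korobov_term_def by (simp only: of_real_inverse divide_inverse)
  then show ?thesis
    unfolding korobov_kernel_def by presburger
qed

lemma cmod_korobov_term: "cmod (korobov_term \<alpha> u x y h) = korobov_weight \<alpha> u h"
  using norm_exp_i_times [of "2 * pi * (\<Sum>j\<in>u. real_of_int (h j) * (x j - y j))"]
  by (simp only: korobov_term_def norm_mult norm_of_real abs_of_nonneg [OF korobov_weight_nonneg]
      of_real_mult of_real_numeral mult_1 mult_ac)

lemma korobov_term_summable:
  assumes "\<alpha> > 1" "finite u"
  shows "korobov_term \<alpha> u x y summable_on (u \<rightarrow>\<^sub>E (UNIV - {0}))"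
proof (rule abs_summable_summable)
  show "(\<lambda>h. cmod (korobov_term \<alpha> u x y h)) summable_on (u \<rightarrow>\<^sub>E (UNIV - {0}))"
    unfolding cmod_korobov_term by (rule korobov_weight_summable [OF assms])
qed

text \<open>The Weierstrass M-test with the weights as majorants. Uniformity in \<open>x\<close>
  yields continuity of the sum and integration term by term.\<close>

lemma korobov_term_uniform_limit:
  assumes "\<alpha> > 1" "finite u"
  shows "uniform_limit UNIV (\<lambda>F x. \<Sum>h\<in>F. korobov_term \<alpha> u x y h)
           (\<lambda>x. \<Sum>\<^sub>\<infinity>h\<in>u \<rightarrow>\<^sub>E (UNIV - {0}). korobov_term \<alpha> u x y h)
           (finite_subsets_at_top (u \<rightarrow>\<^sub>E (UNIV - {0})))"
  by (rule Weierstrass_m_test_general [OF _ korobov_weight_summable [OF assms]])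
    (simp add: cmod_korobov_term)

lemma continuous_on_korobov_term: "continuous_on S (\<lambda>x. korobov_term \<alpha> u x y h)"
  unfolding korobov_term_def
  by (intro continuous_intros continuous_on_subset [OF continuous_on_product_coordinates]) auto

lemma continuous_on_infsum_korobov_term:
  assumes "\<alpha> > 1" "finite u"
  shows "continuous_on S (\<lambda>x. \<Sum>\<^sub>\<infinity>h\<in>u \<rightarrow>\<^sub>E (UNIV - {0}). korobov_term \<alpha> u x y h)"
proof (rule continuous_on_subset [of UNIV])
  show "continuous_on UNIV (\<lambda>x. \<Sum>\<^sub>\<infinity>h\<in>u \<rightarrow>\<^sub>E (UNIV - {0}). korobov_term \<alpha> u x y h)"
    by (rule uniform_limit_theorem [OF _ korobov_term_uniform_limit [OF assms]])
      (simp_all add: always_eventually continuous_on_sum continuous_on_korobov_term)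
qed simp

lemma cmod_infsum_korobov_term_le:
  assumes "\<alpha> > 1" "finite u"
  shows "cmod (\<Sum>\<^sub>\<infinity>h\<in>u \<rightarrow>\<^sub>E (UNIV - {0}). korobov_term \<alpha> u x y h)
       \<le> (\<Sum>\<^sub>\<infinity>h\<in>u \<rightarrow>\<^sub>E (UNIV - {0}). korobov_weight \<alpha> u h)"
  using norm_infsum_bound [of "korobov_term \<alpha> u x y" "u \<rightarrow>\<^sub>E (UNIV - {0})"] korobov_weight_summable [OF assms]
  by (simp add: cmod_korobov_term)

text \<open>The mode is a product of functions of one coordinate each, and the factor of any
  \<open>j\<close> in \<open>u\<close> integrates to 0 over the unit interval.\<close>

lemma integral_korobov_term:
  assumes "u \<subseteq> {1..s}" "u \<noteq> {}" "h \<in> u \<rightarrow>\<^sub>E (UNIV - {0})"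
  shows "(LINT x:unit_cube s|PiM {1..s} (\<lambda>_. lborel). korobov_term \<alpha> u x y h) = 0"
proof -
  let ?M = "PiM {1..s} (\<lambda>_. lborel :: real measure)"
  \<comment> \<open>The interval indicators are built into the factors so that their product
    reproduces the indicator of the cube; coordinates outside \<open>u\<close> get the factor
    1.\<close>
  define e where "e j t = indicator {0..1} t *\<^sub>R (if j \<in> u then
     exp (2 * complex_of_real pi * \<i> * complex_of_real (real_of_int (h j) * (t - y j))) else 1)" for j and t :: real
  have "(LINT x:unit_cube s|?M. korobov_term \<alpha> u x y h)
      = (LINT x|?M. complex_of_real (korobov_weight \<alpha> u h) * (\<Prod>j\<in>{1..s}. e j (x j)))"
    unfolding set_lebesgue_integral_def
  proof (intro Bochner_Integration.integral_cong refl)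
    fix x assume x: "x \<in> space ?M"
    have ind: "complex_of_real (indicator (unit_cube s) x) = (\<Prod>j\<in>{1..s}. of_real (indicator {0..1} (x j)))"
    proof (cases "x \<in> unit_cube s")
      case True
      then have "x j \<in> {0..1}" if "j \<in> {1..s}" for j
        using that by (auto simp: unit_cube_def PiE_iff)
      with True show ?thesis by simp
    next
      case False
      with x obtain j where "j \<in> {1..s}" "x j \<notin> {0..1}"
        unfolding unit_cube_def space_PiM PiE_iff by blast
      then have "(\<Prod>j\<in>{1..s}. complex_of_real (indicator {0..1} (x j))) = 0"
        by (intro prod_zero bexI [of _ j]) auto
      with False show ?thesis by simp
    qed
    have "exp (2 * complex_of_real pi * \<i> * complex_of_real (\<Sum>j\<in>u. real_of_int (h j) * (x j - y j)))
      = (\<Prod>j\<in>u. exp (2 * complex_of_real pi * \<i> * complex_of_real (real_of_int (h j) * (x j - y j))))"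
      using finite_subset [OF assms(1)] by (subst exp_sum [symmetric]) (auto simp: sum_distrib_left)
    also have "\<dots> = (\<Prod>j\<in>{1..s}. if j \<in> u then
        exp (2 * complex_of_real pi * \<i> * complex_of_real (real_of_int (h j) * (x j - y j))) else 1)"
      using assms(1) by (intro prod.mono_neutral_cong_left) auto
    finally show "indicator (unit_cube s) x *\<^sub>R korobov_term \<alpha> u x y h
        = complex_of_real (korobov_weight \<alpha> u h) * (\<Prod>j\<in>{1..s}. e j (x j))"
      by (simp add: korobov_term_def scaleR_conv_of_real ind e_def prod.distrib)
  qed
  also have "\<dots> = complex_of_real (korobov_weight \<alpha> u h) * (\<Prod>j\<in>{1..s}. LINT t|lborel. e j t)"
  proof -
    have "integrable lborel (e j)" for j
      unfolding e_def       by (intro borel_integrable_compact; cases "j \<in> u") (auto intro!: continuous_intros)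
    then show ?thesis
      by (subst integral_mult_right_zero, subst lborel_product.product_integral_prod) auto
  qed
  also have "(\<Prod>j\<in>{1..s}. LINT t|lborel. e j t) = 0"
  proof -
    obtain j where j: "j \<in> u" using assms by blast
    then have "(LINT t|lborel. e j t) = 0"
      unfolding e_def using integral_unit_interval_exp [of "h j" "y j"] PiE_mem [OF assms(3) j] by simp
    then show ?thesis using j assms(1) by (intro prod_zero) auto
  qed
  finally show ?thesis by simp
qed

text \<open>Some finite partial sum is uniformly within \<open>e\<close> of the series and has
  integral 0, so the integral has modulus at most \<open>e\<close>, for every
  \<open>e > 0\<close>.\<close>

lemma integral_infsum_korobov_term:
  assumes "\<alpha> > 1" "u \<subseteq> {1..s}" "u \<noteq> {}"
  shows "(LINT x:unit_cube s|PiM {1..s} (\<lambda>_. lborel).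
           \<Sum>\<^sub>\<infinity>h\<in>u \<rightarrow>\<^sub>E (UNIV - {0}). korobov_term \<alpha> u x y h) = 0" (is "?I = 0")
proof -
  let ?M = "PiM {1..s} (\<lambda>_. lborel :: real measure)"
  let ?S = "\<lambda>x. \<Sum>\<^sub>\<infinity>h\<in>u \<rightarrow>\<^sub>E (UNIV - {0}). korobov_term \<alpha> u x y h"
  have fin: "finite u" using finite_subset [OF assms(2)] by simp
  have "cmod ?I \<le> e" if "e > 0" for e
  proof -
    have "\<forall>\<^sub>F F in finite_subsets_at_top (u \<rightarrow>\<^sub>E (UNIV - {0})).
        (\<forall>x\<in>UNIV. dist (\<Sum>h\<in>F. korobov_term \<alpha> u x y h) (?S x) < e)"
      using korobov_term_uniform_limit [OF assms(1) fin] that by (rule uniform_limitD)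
    then obtain F where F: "finite F" "F \<subseteq> u \<rightarrow>\<^sub>E (UNIV - {0})"
      "\<And>x. dist (\<Sum>h\<in>F. korobov_term \<alpha> u x y h) (?S x) < e"
      unfolding eventually_finite_subsets_at_top by (metis UNIV_I order_refl)
    let ?F = "\<lambda>x. \<Sum>h\<in>F. korobov_term \<alpha> u x y h"
    have intS: "set_integrable ?M (unit_cube s) ?S"
      by (rule continuous_on_cube_integral(1) [OF continuous_on_infsum_korobov_term cmod_infsum_korobov_term_le])
        (use assms fin in auto)
    have intT: "set_integrable ?M (unit_cube s) (\<lambda>x. korobov_term \<alpha> u x y h)" for h
      by (rule continuous_on_cube_integral(1) [OF continuous_on_korobov_term, of _ _ _ _ _ "korobov_weight \<alpha> u h"])
        (simp add: cmod_korobov_term)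
    have intF: "set_integrable ?M (unit_cube s) ?F"
      using intT unfolding set_integrable_def scaleR_sum_right by (intro Bochner_Integration.integrable_sum)
    have "(LINT x:unit_cube s|?M. ?F x) = (\<Sum>h\<in>F. LINT x:unit_cube s|?M. korobov_term \<alpha> u x y h)"
      using intT unfolding set_integrable_def set_lebesgue_integral_def scaleR_sum_right
      by (intro Bochner_Integration.integral_sum)
    also have "\<dots> = 0"
      using F(2) assms integral_korobov_term by (intro sum.neutral) blast
    finally have "?I = (LINT x:unit_cube s|?M. ?S x - ?F x)"
      using intS intF by (simp add: set_integral_diff)
    also have "cmod \<dots> \<le> e"
    proof (rule continuous_on_cube_integral(2))
      show "continuous_on (unit_cube s) (\<lambda>x. ?S x - ?F x)"
        using assms fin by (intro continuous_on_diff continuous_on_infsum_korobov_term continuous_on_sum continuous_on_korobov_term)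
      show "cmod (?S x - ?F x) \<le> e" for x
        using F(3) [of x] by (simp add: dist_norm norm_minus_commute)
    qed
    finally show ?thesis .
  qed
  then have "cmod ?I \<le> 0" by (rule dense_ge)
  then show ?thesis by simp
qed

lemma continuous_on_korobov_kernel:
  assumes "\<alpha> > 1"
  shows "continuous_on S (\<lambda>x. korobov_kernel s \<alpha> \<gamma> x y)"
  unfolding korobov_kernel_eq
proof (intro continuous_on_add continuous_on_sum continuous_on_mult continuous_on_const)
  fix u assume "u \<in> Pow {1..s} - {{}}"
  then have "finite u" by (meson DiffD1 PowD finite_atLeastAtMost finite_subset)
  then show "continuous_on S (\<lambda>x. \<Sum>\<^sub>\<infinity>h\<in>u \<rightarrow>\<^sub>E (UNIV - {0}). korobov_term \<alpha> u x y h)"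
    by (rule continuous_on_infsum_korobov_term [OF assms])
qed

text \<open>On the diagonal all phases vanish. The value is the same for every \<open>x\<close>, so
  the kernel functions at points of the cube all have equal norm.\<close>

lemma korobov_kernel_diagonal:
  assumes "\<alpha> > 1"
  shows "korobov_kernel s \<alpha> \<gamma> x x = complex_of_real (1 + (\<Sum>u\<in>Pow {1..s} - {{}}. \<gamma> u *
      (\<Sum>\<^sub>\<infinity>h\<in>u \<rightarrow>\<^sub>E (UNIV - {0}). korobov_weight \<alpha> u h)))"
proof -
  have "(\<Sum>\<^sub>\<infinity>h\<in>u \<rightarrow>\<^sub>E (UNIV - {0}). korobov_term \<alpha> u x x h)
      = complex_of_real (\<Sum>\<^sub>\<infinity>h\<in>u \<rightarrow>\<^sub>E (UNIV - {0}). korobov_weight \<alpha> u h)"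
    if "u \<in> Pow {1..s} - {{}}" for u
  proof -
    have "finite u" using that by (meson DiffD1 PowD finite_atLeastAtMost finite_subset)
    then have "((\<lambda>h. complex_of_real (korobov_weight \<alpha> u h)) has_sum
        complex_of_real (\<Sum>\<^sub>\<infinity>h\<in>u \<rightarrow>\<^sub>E (UNIV - {0}). korobov_weight \<alpha> u h)) (u \<rightarrow>\<^sub>E (UNIV - {0}))"
      by (intro has_sum_of_real has_sum_infsum korobov_weight_summable assms)
    moreover have "korobov_term \<alpha> u x x = (\<lambda>h. complex_of_real (korobov_weight \<alpha> u h))"
      by (simp add: korobov_term_def fun_eq_iff)
    ultimately show ?thesis by (simp only: infsumI)
  qed
  then show ?thesis
    unfolding korobov_kernel_eq by (simp only: of_real_add of_real_sum of_real_mult of_real_1 cong: sum.cong)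
qed

text \<open>Only the constant mode survives integration.\<close>

lemma integral_korobov_kernel:
  assumes "\<alpha> > 1"
  shows "(LINT x:unit_cube s|PiM {1..s} (\<lambda>_. lborel). korobov_kernel s \<alpha> \<gamma> x y) = 1"
proof -
  let ?M = "PiM {1..s} (\<lambda>_. lborel :: real measure)"
  let ?G = "\<lambda>u x. complex_of_real (\<gamma> u) * (\<Sum>\<^sub>\<infinity>h\<in>u \<rightarrow>\<^sub>E (UNIV - {0}). korobov_term \<alpha> u x y h)"
  let ?U = "Pow {1..s} - {{}}"
  have fin: "finite u" if "u \<in> ?U" for u
    using that by (meson DiffD1 PowD finite_atLeastAtMost finite_subset)
  have one: "set_integrable ?M (unit_cube s) (\<lambda>x. 1 :: complex)"
    by (rule continuous_on_cube_integral(1) [of _ _ 1]) simp_all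
  have int: "set_integrable ?M (unit_cube s) (?G u)" if "u \<in> ?U" for u
    by (intro set_integrable_mult_right
        continuous_on_cube_integral(1) [OF continuous_on_infsum_korobov_term cmod_infsum_korobov_term_le])
      (use assms fin [OF that] in auto)
  have intS: "set_integrable ?M (unit_cube s) (\<lambda>x. \<Sum>u\<in>?U. ?G u x)"
    using int unfolding set_integrable_def scaleR_sum_right by (intro Bochner_Integration.integrable_sum)
  have "(LINT x:unit_cube s|?M. \<Sum>u\<in>?U. ?G u x) = (\<Sum>u\<in>?U. LINT x:unit_cube s|?M. ?G u x)"
    using int unfolding set_integrable_def set_lebesgue_integral_def scaleR_sum_right
    by (intro Bochner_Integration.integral_sum)
  also have "\<dots> = 0"
  proof (intro sum.neutral ballI)
    fix u assume "u \<in> ?U"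
    then show "(LINT x:unit_cube s|?M. ?G u x) = 0"
      using integral_infsum_korobov_term [OF assms, of u s y] by (subst set_integral_mult_right) auto
  qed
  finally have "(LINT x:unit_cube s|?M. 1 + (\<Sum>u\<in>?U. ?G u x)) = (LINT x:unit_cube s|?M. 1)"
    using one intS by (subst set_integral_add(2)) auto
  also have "\<dots> = 1" by (rule integral_unit_cube_1)
  finally show ?thesis unfolding korobov_kernel_eq .
qed

section \<open>Orthogonality of characters on the lattice\<close>

text \<open>The sum of the weights over the dual lattice. The factor \<open>\<gamma> u\<close> stays
  outside so that the exponent can be changed to \<open>\<alpha> * lam\<close> on its own.\<close>

definition dual_sum :: "real \<Rightarrow> nat \<Rightarrow> nat set \<Rightarrow> (nat \<Rightarrow> int) \<Rightarrow> real"
  where "dual_sum a N u \<xi> =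
    (\<Sum>\<^sub>\<infinity>h\<in>{h \<in> u \<rightarrow>\<^sub>E (UNIV - {0}). int N dvd (\<Sum>j\<in>u. h j * \<xi> j)}. korobov_weight a u h)"

text \<open>\<open>\<omega>\<close> is an \<open>N\<close>-th root of unity, equal to 1 exactly when
  \<open>N\<close> divides \<open>c\<close>; otherwise the geometric sum vanishes.\<close>

lemma sum_roots_of_unity:
  fixes c :: int
  assumes "N > 0"
  defines "\<omega> \<equiv> exp (2 * complex_of_real pi * \<i> * complex_of_real (real_of_int c / real N))"
  shows "(\<Sum>n<N. \<omega> ^ n) = (if int N dvd c then of_nat N else 0)"
proof (cases "int N dvd c")
  case True
  then obtain k where k: "c = int N * k" by blast
  have "real_of_int c / real N = of_int k" using assms(1) by (simp add: k)
  then have "\<omega> = 1"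
    using exp_integer_2pi [of "of_int k"] by (simp add: \<omega>_def mult_ac)
  then show ?thesis using True by simp
next
  case False
  have "\<omega> \<noteq> 1"
  proof
    assume "\<omega> = 1"
    then obtain k :: int where "2 * pi * (real_of_int c / real N) = of_int (2 * k) * pi"
      unfolding \<omega>_def exp_eq_1 by auto
    then have "real_of_int c = real_of_int (k * int N)" using assms(1) by (simp add: field_simps)
    then have "c = k * int N" by (simp only: of_int_eq_iff)
    with False show False by simp
  qed
  moreover have "\<omega> ^ N = 1"
  proof -
    have "\<omega> ^ N = exp (of_nat N * (2 * complex_of_real pi * \<i> * complex_of_real (real_of_int c / real N)))"
      unfolding \<omega>_def by (rule exp_of_nat_mult [symmetric])
    also have "of_nat N * (2 * complex_of_real pi * \<i> * complex_of_real (real_of_int c / real N))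
        = 2 * of_int c * complex_of_real pi * \<i>"
      using assms(1) by simp
    finally show ?thesis using exp_integer_2pi [of "of_int c"] by simp
  qed
  ultimately show ?thesis using False by (simp add: sum_gp_strict)
qed

text \<open>Taking fractional parts changes the phase only by full turns, so the mode depends on
  \<open>n\<close> and \<open>k\<close> through powers of one root of unity.\<close>

lemma korobov_term_lattice_point:
  fixes \<xi> h :: "nat \<Rightarrow> int"
  assumes "u \<subseteq> {1..s}" "N > 0"
  defines "\<omega> \<equiv> exp (2 * complex_of_real pi * \<i> *
                     complex_of_real (real_of_int (\<Sum>j\<in>u. h j * \<xi> j) / real N))"
  shows "korobov_term \<alpha> u (lattice_point N s \<xi> n) (lattice_point N s \<xi> k) h
       = \<omega> ^ n * cnj (\<omega> ^ k) * complex_of_real (korobov_weight \<alpha> u h)"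
proof -
  define c where "c = (\<Sum>j\<in>u. h j * \<xi> j)"
  define a where "a n j = real n * real_of_int (\<xi> j) / real N" for n :: nat and j
  \<comment> \<open>\<open>l\<close> gathers the integer parts that \<open>frac\<close>
    removes.\<close>
  define l where "l = (\<Sum>j\<in>u. h j * (\<lfloor>a k j\<rfloor> - \<lfloor>a n j\<rfloor>))"
  have "(\<Sum>j\<in>u. real_of_int (h j) * (lattice_point N s \<xi> n j - lattice_point N s \<xi> k j))
      = (\<Sum>j\<in>u. real_of_int (h j) * (a n j - a k j) + real_of_int (h j * (\<lfloor>a k j\<rfloor> - \<lfloor>a n j\<rfloor>)))"
    using assms(1) by (intro sum.cong) (auto simp: lattice_point_def frac_def a_def algebra_simps)
  also have "\<dots> = (\<Sum>j\<in>u. real_of_int (h j) * (a n j - a k j)) + real_of_int l"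
    by (simp only: sum.distrib l_def of_int_sum)
  also have "(\<Sum>j\<in>u. real_of_int (h j) * (a n j - a k j)) = (real n - real k) * (real_of_int c / real N)"
    unfolding c_def a_def of_int_sum sum_divide_distrib sum_distrib_left
    by (intro sum.cong refl) (simp add: algebra_simps diff_divide_distrib)
  finally have S: "(\<Sum>j\<in>u. real_of_int (h j) * (lattice_point N s \<xi> n j - lattice_point N s \<xi> k j))
      = (real n - real k) * (real_of_int c / real N) + real_of_int l" .
  have pow: "\<omega> ^ i = exp (2 * complex_of_real pi * \<i> * complex_of_real (real i * (real_of_int c / real N)))" for i
    unfolding \<omega>_def c_def exp_of_nat_mult [symmetric] by (simp add: mult_ac)
  have "cnj (\<omega> ^ k) = exp (- (2 * complex_of_real pi * \<i> * complex_of_real (real k * (real_of_int c / real N))))"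
    unfolding pow exp_cnj by simp
  then have "\<omega> ^ n * cnj (\<omega> ^ k) * exp (2 * of_int l * complex_of_real pi * \<i>)
      = exp (2 * complex_of_real pi * \<i> * complex_of_real ((real n - real k) * (real_of_int c / real N) + real_of_int l))"
    unfolding pow by (simp only: exp_add [symmetric]) (rule arg_cong [of _ _ exp], simp add: algebra_simps diff_divide_distrib)
  moreover have "exp (2 * of_int l * complex_of_real pi * \<i>) = 1"
    using exp_integer_2pi [of "of_int l"] by simp
  ultimately show ?thesis unfolding korobov_term_def S by simp
qed

text \<open>For each \<open>h\<close> the double sum is the weight times the squared modulus of a
  character sum, which is \<open>(real N)\<^sup>2\<close> on the dual lattice and 0 off it.\<close>

lemma sum_infsum_korobov_term_lattice:
  fixes \<xi> :: "nat \<Rightarrow> int"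
  assumes "u \<subseteq> {1..s}" "N > 0" "\<alpha> > 1"
  shows "(\<Sum>k<N. \<Sum>n<N. \<Sum>\<^sub>\<infinity>h\<in>u \<rightarrow>\<^sub>E (UNIV - {0}).
            korobov_term \<alpha> u (lattice_point N s \<xi> n) (lattice_point N s \<xi> k) h)
         = complex_of_real ((real N)\<^sup>2 * dual_sum \<alpha> N u \<xi>)"
proof -
  have fin: "finite u" using finite_subset [OF assms(1)] by simp
  let ?P = "u \<rightarrow>\<^sub>E (UNIV - {0::int})"
  let ?t = "\<lambda>n k. korobov_term \<alpha> u (lattice_point N s \<xi> n) (lattice_point N s \<xi> k)"
  let ?D = "{h \<in> ?P. int N dvd (\<Sum>j\<in>u. h j * \<xi> j)}"
  have "((\<lambda>h. \<Sum>k<N. \<Sum>n<N. ?t n k h) has_sum (\<Sum>k<N. \<Sum>n<N. infsum (?t n k) ?P)) ?P"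
    by (intro has_sum_sum has_sum_infsum korobov_term_summable assms fin)
  moreover have "(\<Sum>k<N. \<Sum>n<N. ?t n k h)
      = complex_of_real (if int N dvd (\<Sum>j\<in>u. h j * \<xi> j) then (real N)\<^sup>2 * korobov_weight \<alpha> u h else 0)" for h
  proof -
    define \<omega> where "\<omega> = exp (2 * complex_of_real pi * \<i> *
                     complex_of_real (real_of_int (\<Sum>j\<in>u. h j * \<xi> j) / real N))"
    have "(\<Sum>k<N. \<Sum>n<N. ?t n k h)
        = (\<Sum>k<N. \<Sum>n<N. \<omega> ^ n * cnj (\<omega> ^ k) * complex_of_real (korobov_weight \<alpha> u h))"
      unfolding \<omega>_def by (intro sum.cong refl korobov_term_lattice_point assms)
    also have "\<dots> = (\<Sum>n<N. \<omega> ^ n) * cnj (\<Sum>k<N. \<omega> ^ k) * complex_of_real (korobov_weight \<alpha> u h)"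
      by (subst sum.swap) (simp only: sum_distrib_left [symmetric] sum_distrib_right [symmetric] cnj_sum)
    also have "(\<Sum>n<N. \<omega> ^ n) = (if int N dvd (\<Sum>j\<in>u. h j * \<xi> j) then of_nat N else 0)"
      unfolding \<omega>_def by (rule sum_roots_of_unity [OF assms(2)])
    finally show ?thesis by (simp add: power2_eq_square)
  qed
  ultimately have "((\<lambda>h. complex_of_real (if int N dvd (\<Sum>j\<in>u. h j * \<xi> j) then (real N)\<^sup>2 * korobov_weight \<alpha> u h else 0))
      has_sum (\<Sum>k<N. \<Sum>n<N. infsum (?t n k) ?P)) ?P"
    by simp
  moreover have "((\<lambda>h. if int N dvd (\<Sum>j\<in>u. h j * \<xi> j) then (real N)\<^sup>2 * korobov_weight \<alpha> u h else 0)
      has_sum (real N)\<^sup>2 * dual_sum \<alpha> N u \<xi>) ?P"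
  proof -
    have "korobov_weight \<alpha> u summable_on ?D"
      using korobov_weight_summable [OF assms(3) fin] by (rule summable_on_subset_banach) auto
    then have "((\<lambda>h. (real N)\<^sup>2 * korobov_weight \<alpha> u h) has_sum (real N)\<^sup>2 * dual_sum \<alpha> N u \<xi>) ?D"
      unfolding dual_sum_def by (intro has_sum_cmult_right has_sum_infsum)
    then show ?thesis by (rule has_sum_cong_neutral [THEN iffD1, rotated -1]) auto
  qed
  then have "((\<lambda>h. complex_of_real (if int N dvd (\<Sum>j\<in>u. h j * \<xi> j) then (real N)\<^sup>2 * korobov_weight \<alpha> u h else 0))
      has_sum complex_of_real ((real N)\<^sup>2 * dual_sum \<alpha> N u \<xi>)) ?P"
    by (rule has_sum_of_real)
  ultimately show ?thesis by (rule has_sum_unique)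
qed

lemma lattice_point_in_unit_cube: "lattice_point N s \<xi> n \<in> unit_cube s"
  by (auto simp: lattice_point_def unit_cube_def frac_lt_1 less_imp_le)

section \<open>The worst-case error\<close>

context
  fixes s :: nat and \<alpha> :: real and \<gamma> :: "nat set \<Rightarrow> real"
    and H :: "((nat \<Rightarrow> real) \<Rightarrow> complex) set"
    and ip :: "((nat \<Rightarrow> real) \<Rightarrow> complex) \<Rightarrow> ((nat \<Rightarrow> real) \<Rightarrow> complex) \<Rightarrow> complex"
  assumes alpha: "\<alpha> > 1"
    and korobov: "rkhs (unit_cube s) (korobov_kernel s \<alpha> \<gamma>) H ip"
begin

interpretation rkhs "unit_cube s" "korobov_kernel s \<alpha> \<gamma>" H ip
  by (rule korobov)

abbreviation "kernel_at y \<equiv> (\<lambda>x. if x \<in> unit_cube s then korobov_kernel s \<alpha> \<gamma> x y else 0)"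

abbreviation "cube_integral f \<equiv> (LINT x:unit_cube s|PiM {1..s} (\<lambda>_. lborel). f x)"

abbreviation "one_on_cube \<equiv> (\<lambda>x. if x \<in> unit_cube s then 1 else 0 :: complex)"

lemma ip_norm_kernel_at:
  assumes "x \<in> unit_cube s" "y \<in> unit_cube s"
  shows "ip_norm ip (kernel_at x) = ip_norm ip (kernel_at y)"
proof -
  have "ip (kernel_at x) (kernel_at x) = ip (kernel_at y) (kernel_at y)"
    using assms by (simp add: reproducing kernel_in korobov_kernel_diagonal [OF alpha])
  then show ?thesis by (simp only: ip_norm_def)
qed

text \<open>The reproducing property and Cauchy-Schwarz. A single \<open>C\<close> serves all points
  because the norm of the kernel functions is constant on the cube; the origin is the reference
  point.\<close>

lemma ip_norm_bound:
  obtains C where "\<And>f x. f \<in> H \<Longrightarrow> x \<in> unit_cube s \<Longrightarrow> cmod (f x) \<le> C * ip_norm ip f"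
proof
  let ?o = "(\<lambda>j\<in>{1..s}. 0) :: nat \<Rightarrow> real"
  have o: "?o \<in> unit_cube s" by (simp add: unit_cube_def)
  fix f x assume f: "f \<in> H" and x: "x \<in> unit_cube s"
  have "cmod (f x) = cmod (ip f (kernel_at x))" by (simp add: reproducing [OF f x])
  also have "\<dots> \<le> ip_norm ip f * ip_norm ip (kernel_at x)"
    by (rule ip_Cauchy_Schwarz [OF f kernel_in [OF x]])
  also have "\<dots> = ip_norm ip (kernel_at ?o) * ip_norm ip f"
    unfolding ip_norm_kernel_at [OF x o] by (rule mult.commute)
  finally show "cmod (f x) \<le> ip_norm ip (kernel_at ?o) * ip_norm ip f" .
qed

text \<open>\<open>f x - f y\<close> is the inner product of \<open>f\<close> with the difference of
  the kernel functions at \<open>x\<close> and \<open>y\<close>. As the diagonal is constant, the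
  squared norm of that difference is twice the real part of K(y,y) - K(x,y), which tends to 0 by
  continuity of the kernel in its first argument.\<close>

lemma continuous_on_H:
  assumes f: "f \<in> H"
  shows "continuous_on (unit_cube s) f"
  unfolding continuous_on_def
proof
  fix y assume y: "y \<in> unit_cube s"
  let ?K = "\<lambda>x. korobov_kernel s \<alpha> \<gamma> x y"
  define r where "r x = ip_norm ip f * sqrt (2 * (Re (?K y) - Re (?K x)))" for x
  have bound: "cmod (f x - f y) \<le> r x" if x: "x \<in> unit_cube s" for x
  proof -
    have "f x - f y = ip f (\<lambda>t. kernel_at x t - kernel_at y t)"
      unfolding ip_diff_right [OF kernel_in [OF x] kernel_in [OF y] f] by (simp only: reproducing [OF f x] reproducing [OF f y])
    then have "cmod (f x - f y) \<le> ip_norm ip f * ip_norm ip (\<lambda>t. kernel_at x t - kernel_at y t)"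
      using ip_Cauchy_Schwarz [OF f diff_closed [OF kernel_in [OF x] kernel_in [OF y]]] by metis
    also have "ip_norm ip (\<lambda>t. kernel_at x t - kernel_at y t) = sqrt (2 * (Re (?K y) - Re (?K x)))"
    proof -
      have "ip (kernel_at y) (kernel_at y) = ?K y"
        using y by (simp add: reproducing [OF kernel_in [OF y] y])
      then have n: "(ip_norm ip (kernel_at y))\<^sup>2 = Re (?K y)"
        using ip_self [OF kernel_in [OF y]] by (metis Re_complex_of_real)
      have "ip (kernel_at y) (kernel_at x) = ?K x"
        using x by (simp add: reproducing [OF kernel_in [OF y] x])
      then have "Re (ip (kernel_at x) (kernel_at y)) = Re (?K x)"
        using ip_commute [OF kernel_in [OF y] kernel_in [OF x]] by simp
      then have "(ip_norm ip (\<lambda>t. kernel_at x t - kernel_at y t))\<^sup>2 = 2 * (Re (?K y) - Re (?K x))"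
        unfolding ip_norm_square_diff [OF kernel_in [OF x] kernel_in [OF y]] ip_norm_kernel_at [OF x y] n by simp
      then show ?thesis
        using ip_norm_nonneg [OF diff_closed [OF kernel_in [OF x] kernel_in [OF y]]]
        by (rule real_sqrt_unique [symmetric])
    qed
    finally show ?thesis unfolding r_def .
  qed
  have "continuous_on (unit_cube s) r"
    unfolding r_def by (intro continuous_intros continuous_on_korobov_kernel alpha)
  then have "(r \<longlongrightarrow> r y) (at y within unit_cube s)"
    using y by (simp add: continuous_on_def)
  then have "(r \<longlongrightarrow> 0) (at y within unit_cube s)"
    by (simp add: r_def)
  moreover have "\<forall>\<^sub>F x in at y within unit_cube s. cmod (f x - f y) \<le> r x"
    using bound by (simp add: eventually_at_filter)
  ultimately have "((\<lambda>x. f x - f y) \<longlongrightarrow> 0) (at y within unit_cube s)"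
    by (rule Lim_null_comparison [rotated])
  then show "(f \<longlongrightarrow> f y) (at y within unit_cube s)"
    by (simp add: Lim_null [symmetric])
qed

lemma set_integrable_H: "f \<in> H \<Longrightarrow> set_integrable (PiM {1..s} (\<lambda>_. lborel)) (unit_cube s) f"
proof -
  assume f: "f \<in> H"
  obtain C where "\<And>f x. f \<in> H \<Longrightarrow> x \<in> unit_cube s \<Longrightarrow> cmod (f x) \<le> C * ip_norm ip f"
    using ip_norm_bound by blast
  then show ?thesis
    using continuous_on_cube_integral(1) [OF continuous_on_H [OF f]] f by blast
qed

lemma cube_integral_kernel_at:
  "cube_integral (kernel_at y) = 1"
proof -
  have "cube_integral (kernel_at y) = cube_integral (\<lambda>x. korobov_kernel s \<alpha> \<gamma> x y)"
    by (intro set_lebesgue_integral_cong unit_cube_sets) simp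
  also have "\<dots> = 1" by (rule integral_korobov_kernel [OF alpha])
  finally show ?thesis .
qed

text \<open>At a point \<open>y\<close> of the cube, the Riesz representer of integration takes the
  conjugate of the integral of the kernel function at \<open>y\<close>, that is 1. This also shows
  that the constant 1 lies in \<open>H\<close>.\<close>

lemma cube_integral_representer:
  "one_on_cube \<in> H" "f \<in> H \<Longrightarrow> cube_integral f = ip f one_on_cube"
proof -
  obtain C where C: "\<And>f x. f \<in> H \<Longrightarrow> x \<in> unit_cube s \<Longrightarrow> cmod (f x) \<le> C * ip_norm ip f"
    using ip_norm_bound by blast
  have "\<exists>g\<in>H. \<forall>f\<in>H. cube_integral f = ip f g"
  proof (rule Riesz_representation)
    show "cmod (cube_integral f) \<le> C * ip_norm ip f" if "f \<in> H" for f
      by (rule continuous_on_cube_integral(2) [OF continuous_on_H [OF that] C [OF that]])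
    show "cube_integral (\<lambda>x. f x + g x) = cube_integral f + cube_integral g" if "f \<in> H" "g \<in> H" for f g
      by (rule set_integral_add(2) [OF set_integrable_H [OF that(1)] set_integrable_H [OF that(2)]])
  qed simp
  then obtain g where g: "g \<in> H" "\<And>f. f \<in> H \<Longrightarrow> cube_integral f = ip f g" by blast
  have "g = one_on_cube"
  proof
    fix y show "g y = one_on_cube y"
    proof (cases "y \<in> unit_cube s")
      case True
      have "g y = ip g (kernel_at y)" using reproducing [OF g(1) True] by simp
      also have "\<dots> = cnj (ip (kernel_at y) g)" by (rule ip_commute [OF kernel_in [OF True] g(1)])
      also have "ip (kernel_at y) g = 1"
        using g(2) [OF kernel_in [OF True]] cube_integral_kernel_at by simp
      finally show ?thesis using True by simp
    qed (simp add: zero_outside [OF g(1)])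
  qed
  with g show "one_on_cube \<in> H" "f \<in> H \<Longrightarrow> cube_integral f = ip f one_on_cube" by simp_all
qed

text \<open>The error functional is represented by 1 minus \<open>q\<close>, where \<open>q\<close>
  is the mean of the kernel functions at the lattice points. The squared norm of 1 and its inner
  product with \<open>q\<close> are both 1, so they contribute 1 - 2 and cancel the constant 1 in
  the squared norm of \<open>q\<close>.\<close>

theorem worst_case_error_square:
  assumes N: "N > 0"
  shows "(worst_case_error H ip N s \<xi>)\<^sup>2 = (\<Sum>u\<in>Pow {1..s} - {{}}. \<gamma> u * dual_sum \<alpha> N u \<xi>)"
proof -
  let ?p = "lattice_point N s \<xi>"
  define q where "q = (\<lambda>x. complex_of_real (1 / real N) * (\<Sum>n<N. kernel_at (?p n) x))"
  note p = lattice_point_in_unit_cube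
  have sum_in: "(\<lambda>x. \<Sum>n<N. kernel_at (?p n) x) \<in> H"
    by (intro sum_closed kernel_in p)
  have q: "q \<in> H" unfolding q_def by (rule scale_closed [OF sum_in])
  have ip_q: "ip f q = (\<Sum>n<N. f (?p n)) / of_nat N" if f: "f \<in> H" for f
  proof -
    have "ip (\<lambda>x. \<Sum>n<N. kernel_at (?p n) x) f = (\<Sum>n<N. ip (kernel_at (?p n)) f)"
      by (rule ip_sum [OF kernel_in [OF p] f])
    also have "\<dots> = (\<Sum>n<N. cnj (f (?p n)))"
      using ip_commute [OF f kernel_in [OF p]] reproducing [OF f p] by simp
    finally have "ip f (\<lambda>x. \<Sum>n<N. kernel_at (?p n) x) = (\<Sum>n<N. f (?p n))"
      using ip_commute [OF sum_in f] by simp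
    then show ?thesis unfolding q_def ip_scale_right [OF sum_in f] by simp
  qed
  note one = cube_integral_representer
  have err: "cube_integral f - (\<Sum>n<N. f (?p n)) / of_nat N = ip f (\<lambda>x. one_on_cube x - q x)" if "f \<in> H" for f
    unfolding ip_diff_right [OF one(1) q that] ip_q [OF that] one(2) [OF that] by (rule refl)
  have "worst_case_error H ip N s \<xi>
      = (SUP f\<in>{f \<in> H. ip_norm ip f \<le> 1}. cmod (ip f (\<lambda>x. one_on_cube x - q x)))"
    unfolding worst_case_error_def
    by (intro SUP_cong refl arg_cong [of _ _ cmod] err) simp
  also have "\<dots> = ip_norm ip (\<lambda>x. one_on_cube x - q x)"
    by (rule Sup_representer [OF diff_closed [OF one(1) q]])
  finally have "(worst_case_error H ip N s \<xi>)\<^sup>2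
      = (ip_norm ip one_on_cube)\<^sup>2 - 2 * Re (ip one_on_cube q) + (ip_norm ip q)\<^sup>2"
    using ip_norm_square_diff [OF one(1) q] by simp
  also have "(ip_norm ip one_on_cube)\<^sup>2 = 1"
  proof -
    have "cube_integral one_on_cube = 1"
      by (rule trans [OF set_lebesgue_integral_cong [OF unit_cube_sets] integral_unit_cube_1]) simp
    then have "complex_of_real ((ip_norm ip one_on_cube)\<^sup>2) = complex_of_real 1"
      using one(2) [OF one(1)] ip_self [OF one(1)] by simp
    then show ?thesis by (simp only: of_real_eq_iff)
  qed
  also have "ip one_on_cube q = 1"
    using N by (simp add: ip_q [OF one(1)] p)
  \<comment> \<open>\<open>ip q q\<close> is the mean of the kernel over all pairs of lattice
    points; the constant mode gives the 1.\<close>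
  also have "(ip_norm ip q)\<^sup>2 = 1 + (\<Sum>u\<in>Pow {1..s} - {{}}. \<gamma> u * dual_sum \<alpha> N u \<xi>)"
  proof -
    let ?G = "\<lambda>u n k. \<Sum>\<^sub>\<infinity>h\<in>u \<rightarrow>\<^sub>E (UNIV - {0}). korobov_term \<alpha> u (?p k) (?p n) h"
    let ?S = "\<Sum>u\<in>Pow {1..s} - {{}}. \<gamma> u * dual_sum \<alpha> N u \<xi>"
    have "complex_of_real ((ip_norm ip q)\<^sup>2) = ip q q" by (rule ip_self [OF q, symmetric])
    also have "\<dots> = (\<Sum>k<N. \<Sum>n<N. korobov_kernel s \<alpha> \<gamma> (?p k) (?p n)) / (of_nat N)\<^sup>2"
      unfolding ip_q [OF q] by (simp add: q_def p sum_divide_distrib [symmetric] power2_eq_square)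
    also have "(\<Sum>k<N. \<Sum>n<N. korobov_kernel s \<alpha> \<gamma> (?p k) (?p n))
        = (\<Sum>k<N. \<Sum>n<N. 1) + (\<Sum>u\<in>Pow {1..s} - {{}}. complex_of_real (\<gamma> u) * (\<Sum>n<N. \<Sum>k<N. ?G u n k))"
    proof -
      have "(\<Sum>k<N. \<Sum>n<N. korobov_kernel s \<alpha> \<gamma> (?p k) (?p n))
          = (\<Sum>n<N. \<Sum>k<N. korobov_kernel s \<alpha> \<gamma> (?p k) (?p n))" by (rule sum.swap)
      also have "\<dots> = (\<Sum>n<N. (\<Sum>k<N. 1) + (\<Sum>u\<in>Pow {1..s} - {{}}. \<Sum>k<N. complex_of_real (\<gamma> u) * ?G u n k))"
        unfolding korobov_kernel_eq sum.distrib by (subst sum.swap [of _ _ "{..<N}"]) (rule refl)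
      also have "\<dots> = (\<Sum>n<N. \<Sum>k<N. 1) + (\<Sum>u\<in>Pow {1..s} - {{}}. \<Sum>n<N. \<Sum>k<N. complex_of_real (\<gamma> u) * ?G u n k)"
        unfolding sum.distrib by (subst sum.swap [of _ _ "{..<N}"]) (rule refl)
      finally show ?thesis by (simp only: sum_distrib_left)
    qed
    also have "(\<Sum>u\<in>Pow {1..s} - {{}}. complex_of_real (\<gamma> u) * (\<Sum>n<N. \<Sum>k<N. ?G u n k))
        = (\<Sum>u\<in>Pow {1..s} - {{}}. complex_of_real (\<gamma> u) * complex_of_real ((real N)\<^sup>2 * dual_sum \<alpha> N u \<xi>))"
      by (intro sum.cong refl arg_cong2 [of _ _ _ _ "(*)"] sum_infsum_korobov_term_lattice [OF _ N alpha]) auto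
    also have "\<dots> = complex_of_real ((real N)\<^sup>2 * ?S)"
      by (simp only: of_real_sum of_real_mult sum_distrib_left mult.left_commute)
    also have "((\<Sum>k<N. \<Sum>n<N. 1) + complex_of_real ((real N)\<^sup>2 * ?S)) / (of_nat N)\<^sup>2 = complex_of_real (1 + ?S)"
      using N by (simp add: add_divide_distrib power2_eq_square del: of_real_sum)
    finally show ?thesis by (simp only: of_real_eq_iff)
  qed
  finally show ?thesis by simp
qed

end

section \<open>Subadditivity and averaging\<close>

text \<open>Rescaling to sum 1 reduces the claim to \<open>t \<le> t powr l\<close> on the unit
  interval.\<close>

lemma powr_add_le:
  fixes x y l :: real
  assumes "x \<ge> 0" "y \<ge> 0" "0 < l" "l \<le> 1"
  shows "(x + y) powr l \<le> x powr l + y powr l"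
proof (cases "x + y = 0")
  case False
  then have s: "x + y > 0" using assms by simp
  have *: "t \<le> t powr l" if "0 \<le> t" "t \<le> 1" for t :: real
  proof (cases "t = 0")
    case False
    then show ?thesis using powr_mono' [of l 1 t] that assms by simp
  qed simp
  have "(x + y) powr l = (x + y) powr l * (x / (x + y) + y / (x + y))"
    using s by (simp add: add_divide_distrib [symmetric])
  also have "\<dots> \<le> (x + y) powr l * ((x / (x + y)) powr l + (y / (x + y)) powr l)"
    using s assms by (intro mult_left_mono add_mono *) auto
  also have "\<dots> = x powr l + y powr l"
    using s assms by (simp add: powr_divide distrib_left)
  finally show ?thesis .
qed (use assms in simp)

lemma powr_sum_le:
  fixes f :: "'a \<Rightarrow> real"
  assumes "\<And>i. i \<in> I \<Longrightarrow> f i \<ge> 0" "0 < l" "l \<le> 1"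
  shows "(\<Sum>i\<in>I. f i) powr l \<le> (\<Sum>i\<in>I. f i powr l)"
  using assms(1)
proof (induction I rule: infinite_finite_induct)
  case (insert i I)
  have "(f i + (\<Sum>i\<in>I. f i)) powr l \<le> f i powr l + (\<Sum>i\<in>I. f i) powr l"
    using insert.prems assms(2,3) by (intro powr_add_le sum_nonneg) auto
  also have "\<dots> \<le> f i powr l + (\<Sum>i\<in>I. f i powr l)"
    using insert by simp
  finally show ?case using insert.hyps by simp
qed simp_all

section \<open>Powers and means of dual sums\<close>

lemma korobov_weight_powr: "korobov_weight a u h powr l = korobov_weight (a * l) u h"
  by (simp add: korobov_weight_def prod_powr_distrib powr_powr)

lemma korobov_weight_summable_dual:
  assumes "a > 1" "finite u"
  shows "korobov_weight a u summable_on {h \<in> u \<rightarrow>\<^sub>E (UNIV - {0}). P h}"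
  using korobov_weight_summable [OF assms] by (rule summable_on_subset_banach) auto

lemma dual_sum_nonneg: "dual_sum a N u \<xi> \<ge> 0"
  unfolding dual_sum_def by (intro infsum_nonneg korobov_weight_nonneg)

lemma dual_sum_cong:
  assumes "\<And>j. j \<in> u \<Longrightarrow> \<xi> j = \<eta> j"
  shows "dual_sum a N u \<xi> = dual_sum a N u \<eta>"
proof -
  have "(\<Sum>j\<in>u. h j * \<xi> j) = (\<Sum>j\<in>u. h j * \<eta> j)" for h
    using assms by (intro sum.cong) simp_all
  then show ?thesis by (simp add: dual_sum_def)
qed

text \<open>Subadditivity is available for finite sums. Moving the power to the right as
  \<open>1 / l\<close> leaves a plain infinite sum on the left, which is bounded through its finite
  partial sums.\<close>

lemma dual_sum_powr_le:
  assumes "a > 1" "a * l > 1" "0 < l" "l \<le> 1" "finite u"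
  shows "dual_sum a N u \<xi> powr l \<le> dual_sum (a * l) N u \<xi>"
proof -
  let ?D = "{h \<in> u \<rightarrow>\<^sub>E (UNIV - {0}). int N dvd (\<Sum>j\<in>u. h j * \<xi> j)}"
  have "dual_sum a N u \<xi> \<le> dual_sum (a * l) N u \<xi> powr (1 / l)"
    unfolding dual_sum_def [of a]
  proof (rule infsum_le_finite_sums [OF korobov_weight_summable_dual [OF assms(1,5)]])
    fix F assume F: "finite F" "F \<subseteq> ?D"
    have "sum (korobov_weight a u) F powr l \<le> (\<Sum>h\<in>F. korobov_weight a u h powr l)"
      by (rule powr_sum_le [OF korobov_weight_nonneg assms(3,4)])
    also have "\<dots> = sum (korobov_weight (a * l) u) F"
      by (simp only: korobov_weight_powr)
    also have "\<dots> \<le> dual_sum (a * l) N u \<xi>"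
      unfolding dual_sum_def
      by (rule finite_sum_le_infsum [OF korobov_weight_summable_dual [OF assms(2,5)] F korobov_weight_nonneg])
    finally have "(sum (korobov_weight a u) F powr l) powr (1 / l) \<le> dual_sum (a * l) N u \<xi> powr (1 / l)"
      using assms(3) by (intro powr_mono2) auto
    then show "sum (korobov_weight a u) F \<le> dual_sum (a * l) N u \<xi> powr (1 / l)"
      using assms(3) by (simp add: powr_powr sum_nonneg korobov_weight_nonneg)
  qed
  then have "dual_sum a N u \<xi> powr l \<le> (dual_sum (a * l) N u \<xi> powr (1 / l)) powr l"
    using assms(3) by (intro powr_mono2 dual_sum_nonneg) auto
  then show ?thesis using assms(3) by (simp add: powr_powr dual_sum_nonneg)
qed

text \<open>The bound of \<open>sum_search_space_le\<close> does not depend on the box, and every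
  finite set of tuples lies in some box, so the bound passes to the infinite sums.\<close>

lemma sum_dual_sum_search_space_le:
  assumes "prime b" "a > 1" "finite u" "d \<in> u"
  shows "(\<Sum>y\<in>search_space b m w. dual_sum a (b ^ m) u (\<xi>(d := int b ^ w * y)))
       \<le> card (search_space b m w) * (2 * (2 * zeta a) ^ card u / real b powr max 0 (real m - real w))"
    (is "_ \<le> ?B")
proof -
  let ?P = "u \<rightarrow>\<^sub>E (UNIV - {0::int})"
  let ?f = "\<lambda>y h. if int (b ^ m) dvd (\<Sum>j\<in>u. h j * (\<xi>(d := int b ^ w * y)) j) then korobov_weight a u h else 0"
  have "(?f y has_sum dual_sum a (b ^ m) u (\<xi>(d := int b ^ w * y))) ?P" for y
    unfolding dual_sum_def
    by (rule has_sum_cong_neutral [THEN iffD1, OF _ _ _ has_sum_infsum [OF korobov_weight_summable_dual [OF assms(2,3)]]])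
      auto
  then have sum: "((\<lambda>h. \<Sum>y\<in>search_space b m w. ?f y h)
      has_sum (\<Sum>y\<in>search_space b m w. dual_sum a (b ^ m) u (\<xi>(d := int b ^ w * y)))) ?P"
    by (rule has_sum_sum)
  then show ?thesis
  proof (rule has_sum_le_finite_sums)
    fix F assume F: "finite F" "F \<subseteq> ?P"
    obtain A where A: "finite A" "0 \<notin> A" "F \<subseteq> u \<rightarrow>\<^sub>E A"
      using finite_subset_PiE [OF F(1) assms(3) F(2)] .
    have "(\<Sum>h\<in>F. \<Sum>y\<in>search_space b m w. ?f y h) \<le> (\<Sum>h\<in>u \<rightarrow>\<^sub>E A. \<Sum>y\<in>search_space b m w. ?f y h)"
      using A assms by (intro sum_mono2 finite_PiE sum_nonneg) (simp_all add: korobov_weight_nonneg)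
    also have "\<dots> = (\<Sum>y\<in>search_space b m w. \<Sum>h\<in>u \<rightarrow>\<^sub>E A. ?f y h)"
      by (rule sum.swap)
    also have "\<dots> \<le> ?B"
      by (rule sum_search_space_le [OF assms(1,2) A(1,2) assms(3,4)])
    finally show "(\<Sum>h\<in>F. \<Sum>y\<in>search_space b m w. ?f y h) \<le> ?B" .
  qed
qed

theorem theorem1:
  fixes b m N s :: nat
    and \<alpha> lam :: real
    and \<gamma> :: "nat set \<Rightarrow> real"
    and w :: "nat \<Rightarrow> nat"
    and z0 z :: "nat \<Rightarrow> int"
    and H :: "((nat \<Rightarrow> real) \<Rightarrow> complex) set"
    and ip :: "((nat \<Rightarrow> real) \<Rightarrow> complex) \<Rightarrow> ((nat \<Rightarrow> real) \<Rightarrow> complex) \<Rightarrow> complex"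
  assumes "prime b" and "m \<ge> 1" and "N = b ^ m" and "s \<ge> 1" and "\<alpha> > 1"
    and "\<And>u. u \<subseteq> {1..s} \<Longrightarrow> \<gamma> u > 0" and "\<gamma> {} = 1"
    and "mono_on {1..s} w"
    and "rkhs (unit_cube s) (korobov_kernel s \<alpha> \<gamma>) H ip"
    and "\<And>j. j \<in> {1..s} \<Longrightarrow> z0 j \<in> {0..int N - 1}"
    and "reduced_scs (worst_case_error H ip N s) b m s w z0 z"
    and "1 / \<alpha> < lam" and "lam \<le> 1"
  shows "(worst_case_error H ip N s (\<lambda>j. int b ^ w j * z j))\<^sup>2 \<le>
    (\<Sum>d = 1..s. \<Sum>u \<in> {u. u \<subseteq> {1..s} \<and> d \<in> u}.
       \<gamma> u powr lam * (2 * (2 * zeta (\<alpha> * lam)) ^ card u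
                        / real b powr max 0 (real m - real (w d)))) powr (1 / lam)"
proof -
  let ?U = "Pow {1..s} - {{}}"
  let ?e = "worst_case_error H ip N s"
  let ?B = "\<lambda>d u. 2 * (2 * zeta (\<alpha> * lam)) ^ card u / real b powr max 0 (real m - real (w d))"
  define Y where "Y j = int b ^ w j * z j" for j
  \<comment> \<open>The vector that step \<open>d\<close> evaluates at the candidate
    \<open>y\<close>: selected components before \<open>d\<close>, initial ones after it.\<close>
  define \<xi> where "\<xi> d y = (\<lambda>j. if j < d then Y j else z0 j)(d := int b ^ w d * y)" for d y
  define T where "T u \<eta> = \<gamma> u * dual_sum \<alpha> N u \<eta>" for u \<eta>
  \<comment> \<open>The part of the squared error that can depend on \<open>y\<close>.\<close>
  define \<theta> where "\<theta> d y = (\<Sum>u\<in>{u\<in>?U. d \<in> u}. T u (\<xi> d y))" for d y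
  have N: "N > 0" using assms(1,3) prime_gt_0_nat by simp
  have lam: "0 < lam"
    using assms(5,12) by (meson divide_pos_pos less_trans zero_less_one)
  \<comment> \<open>This is the convergence condition for the zeta value in the bound.\<close>
  have al: "\<alpha> * lam > 1" using assms(5,12) by (simp add: field_simps)
  have fin: "finite u" if "u \<in> ?U" for u
    using that by (meson DiffD1 PowD finite_atLeastAtMost finite_subset)
  have T_nonneg: "T u \<eta> \<ge> 0" if "u \<in> ?U" for u \<eta>
    unfolding T_def using assms(6) [of u] that by (intro mult_nonneg_nonneg dual_sum_nonneg) auto
  have \<theta>_nonneg: "\<theta> d y \<ge> 0" for d y
    unfolding \<theta>_def by (intro sum_nonneg T_nonneg) simp
  have error: "(?e \<eta>)\<^sup>2 = (\<Sum>u\<in>?U. T u \<eta>)" for \<eta>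
    unfolding T_def by (rule worst_case_error_square [OF assms(5,9) N])
  have T_cong: "T u \<eta> = T u \<eta>'" if "\<And>j. j \<in> u \<Longrightarrow> \<eta> j = \<eta>' j" for u \<eta> \<eta>'
    unfolding T_def using dual_sum_cong [of u \<eta> \<eta>'] that by simp
  \<comment> \<open>Sets without \<open>d\<close> contribute the same amount for every candidate, so
    minimizing the whole error minimizes \<open>\<theta> d\<close>.\<close>
  have minimal: "\<theta> d (z d) \<le> \<theta> d y" if d: "d \<in> {1..s}" and y: "y \<in> search_space b m (w d)" for d y
  proof -
    have \<xi>: "(\<lambda>j. if j < d then int b ^ w j * z j else if j = d then int b ^ w d * y else z0 j) = \<xi> d y" for y
      by (auto simp: \<xi>_def Y_def)
    have "is_arg_min (\<lambda>y. (?e (\<xi> d y))\<^sup>2) (\<lambda>y. y \<in> search_space b m (w d)) (z d)"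
      using bspec [OF assms(11) [unfolded reduced_scs_def] d] unfolding \<xi> .
    with y have "\<not> (?e (\<xi> d y))\<^sup>2 < (?e (\<xi> d (z d)))\<^sup>2"
      unfolding is_arg_min_def by blast
    then have "(\<Sum>u\<in>?U. T u (\<xi> d (z d))) \<le> (\<Sum>u\<in>?U. T u (\<xi> d y))"
      unfolding error by simp
    moreover have split: "(\<Sum>u\<in>?U. T u (\<xi> d y)) = \<theta> d y + (\<Sum>u\<in>{u\<in>?U. d \<notin> u}. T u (\<xi> d y))" for y
      unfolding \<theta>_def by (subst sum.union_disjoint [symmetric]) (auto intro!: sum.cong)
    moreover have "(\<Sum>u\<in>{u\<in>?U. d \<notin> u}. T u (\<xi> d (z d))) = (\<Sum>u\<in>{u\<in>?U. d \<notin> u}. T u (\<xi> d y))"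
      by (intro sum.cong refl T_cong) (auto simp: \<xi>_def)
    ultimately show ?thesis by simp
  qed
  have mean: "\<theta> d (z d) powr lam \<le> (\<Sum>u\<in>{u\<in>?U. d \<in> u}. \<gamma> u powr lam * ?B d u)" if d: "d \<in> {1..s}" for d
  proof -
    let ?Z = "search_space b m (w d)"
    let ?V = "{u\<in>?U. d \<in> u}"
    \<comment> \<open>A minimum is at most the mean; the positive factor \<open>card ?Z\<close> is
      cancelled at the end.\<close>
    have "card ?Z * \<theta> d (z d) powr lam = (\<Sum>y\<in>?Z. \<theta> d (z d) powr lam)" by simp
    also have "\<dots> \<le> (\<Sum>y\<in>?Z. \<theta> d y powr lam)"
      using minimal [OF d] \<theta>_nonneg lam by (intro sum_mono powr_mono2) auto
    \<comment> \<open>Subadditivity enters twice: over the sets \<open>u\<close>, and through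
      \<open>dual_sum_powr_le\<close> over the tuples of each dual lattice.\<close>
    also have "\<dots> \<le> (\<Sum>y\<in>?Z. \<Sum>u\<in>?V. \<gamma> u powr lam * dual_sum (\<alpha> * lam) N u (\<xi> d y))"
    proof (intro sum_mono)
      fix y
      have "\<theta> d y powr lam \<le> (\<Sum>u\<in>?V. T u (\<xi> d y) powr lam)"
        unfolding \<theta>_def using T_nonneg lam assms(13) by (intro powr_sum_le) auto
      also have "\<dots> \<le> (\<Sum>u\<in>?V. \<gamma> u powr lam * dual_sum (\<alpha> * lam) N u (\<xi> d y))"
      proof (intro sum_mono)
        fix u assume u: "u \<in> ?V"
        then have "\<gamma> u \<ge> 0" using assms(6) [of u] by auto
        then have "T u (\<xi> d y) powr lam = \<gamma> u powr lam * dual_sum \<alpha> N u (\<xi> d y) powr lam"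
          unfolding T_def by (simp add: powr_mult dual_sum_nonneg)
        also have "\<dots> \<le> \<gamma> u powr lam * dual_sum (\<alpha> * lam) N u (\<xi> d y)"
          using u by (intro mult_left_mono dual_sum_powr_le assms(5,13) al lam fin) auto
        finally show "T u (\<xi> d y) powr lam \<le> \<gamma> u powr lam * dual_sum (\<alpha> * lam) N u (\<xi> d y)" .
      qed
      finally show "\<theta> d y powr lam \<le> (\<Sum>u\<in>?V. \<gamma> u powr lam * dual_sum (\<alpha> * lam) N u (\<xi> d y))" .
    qed
    also have "\<dots> = (\<Sum>u\<in>?V. \<gamma> u powr lam * (\<Sum>y\<in>?Z. dual_sum (\<alpha> * lam) N u (\<xi> d y)))"
      by (subst sum.swap) (simp only: sum_distrib_left)
    also have "\<dots> \<le> (\<Sum>u\<in>?V. \<gamma> u powr lam * (card ?Z * ?B d u))"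
    proof (intro sum_mono mult_left_mono)
      fix u assume "u \<in> ?V"
      then show "(\<Sum>y\<in>?Z. dual_sum (\<alpha> * lam) N u (\<xi> d y)) \<le> card ?Z * ?B d u"
        unfolding \<xi>_def assms(3) using fin by (intro sum_dual_sum_search_space_le assms(1) al) auto
    qed simp
    also have "\<dots> = card ?Z * (\<Sum>u\<in>?V. \<gamma> u powr lam * ?B d u)"
      by (simp only: sum_distrib_left mult.left_commute)
    finally show ?thesis
      using card_search_space_pos [OF assms(1), of m "w d"] by (simp only: mult_le_cancel_left_pos of_nat_0_less_iff)
  qed
  \<comment> \<open>The nonempty sets are grouped by their largest element.\<close>
  have "(?e Y)\<^sup>2 = (\<Sum>d = 1..s. \<Sum>u\<in>{u\<in>?U. Max u = d}. T u Y)"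
    unfolding error
  proof (rule sum.group [symmetric])
    show "Max ` ?U \<subseteq> {1..s}"
    proof (rule image_subsetI)
      fix u assume u: "u \<in> ?U"
      then have "Max u \<in> u" using fin by (intro Max_in) auto
      with u show "Max u \<in> {1..s}" by auto
    qed
  qed simp_all
  also have "\<dots> \<le> (\<Sum>d = 1..s. \<theta> d (z d))"
  proof (intro sum_mono)
    fix d
    have "(\<Sum>u\<in>{u\<in>?U. Max u = d}. T u Y) = (\<Sum>u\<in>{u\<in>?U. Max u = d}. T u (\<xi> d (z d)))"
    proof (intro sum.cong refl T_cong)
      fix u j assume u: "u \<in> {u\<in>?U. Max u = d}" and j: "j \<in> u"
      then have "j \<le> d" using fin [of u] Max_ge [of u j] by simp
      then show "Y j = \<xi> d (z d) j" by (simp add: \<xi>_def Y_def)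
    qed
    also have "\<dots> \<le> \<theta> d (z d)"
      unfolding \<theta>_def
    \<comment> \<open>Sets that contain \<open>d\<close> but have a larger maximum are added; their
      terms are nonnegative.\<close>
    proof (rule sum_mono2)
      show "{u\<in>?U. Max u = d} \<subseteq> {u\<in>?U. d \<in> u}"
        using fin Max_in by blast
    qed (simp_all add: T_nonneg)
    finally show "(\<Sum>u\<in>{u\<in>?U. Max u = d}. T u Y) \<le> \<theta> d (z d)" .
  qed
  finally have "((?e Y)\<^sup>2) powr lam \<le> (\<Sum>d = 1..s. \<theta> d (z d)) powr lam"
    using lam by (intro powr_mono2) auto
  also have "\<dots> \<le> (\<Sum>d = 1..s. \<theta> d (z d) powr lam)"
    by (rule powr_sum_le [OF \<theta>_nonneg lam assms(13)])
  also have "\<dots> \<le> (\<Sum>d = 1..s. \<Sum>u\<in>{u\<in>?U. d \<in> u}. \<gamma> u powr lam * ?B d u)"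
    by (intro sum_mono mean)
  also have "\<dots> = (\<Sum>d = 1..s. \<Sum>u\<in>{u. u \<subseteq> {1..s} \<and> d \<in> u}. \<gamma> u powr lam * ?B d u)"
    by (intro sum.cong refl) auto
  finally have "(((?e Y)\<^sup>2) powr lam) powr (1 / lam)
      \<le> (\<Sum>d = 1..s. \<Sum>u\<in>{u. u \<subseteq> {1..s} \<and> d \<in> u}. \<gamma> u powr lam * ?B d u) powr (1 / lam)"
    using lam by (intro powr_mono2) auto
  moreover have "(((?e Y)\<^sup>2) powr lam) powr (1 / lam) = (?e Y)\<^sup>2"
    using lam by (simp add: powr_powr)
  moreover have "Y = (\<lambda>j. int b ^ w j * z j)" by (simp add: Y_def fun_eq_iff)
  ultimately show ?thesis by simp
qed

end
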